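(* Consider the pay-to-bid game described in the context with $n\ge 2$ players, and consider any symmetric subgame perfect equilibrium (SSPE), both in the version with re-entry and in the version without re-entry. Then: (I) In both versions, in any subgame starting at round $t\in\{1,2,3,\dots\}$, the equilibrium expected utility of a player $i$ whose wealth at the start of round $t$ is $w_{i,t}$ equals exactly $u(w_{i,t})$. (II) With re-entry, in every round each player strictly randomizes over $\{\text{Bid},\text{No Bid}\}$ and plays Bid with the stationary probability $$p = 1-\left(\frac{u(c)}{u(v-s)}\right)^{1/(n-1)};$$ the SSPE is unique and stationary. (III) Without re-entry, in every round $t$ each active player strictly randomizes over $\{\text{Bid},\text{No Bid}\}$ and plays Bid with probability $$p_t = 1-\left(\frac{u(c)}{u(v-s)}\right)^{1/(n_t-1)},$$ where $n_t$ is the number of active players in round $t$; the SSPE is unique and Markov perfect (it depends on the history only through $n_t$, besides the constants $v,s,c$).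
   Context: Pay-to-bid game: an object has monetary value $v>0$ that is common knowledge; there are $n\ge 2$ players; the bid fee is $c>0$ and the fixed sale price is $s\ge 0$, with $c<v-s$. Play proceeds in rounds $t=1,2,3,\dots$ with complete information (all past actions are observed). In each round every active player simultaneously chooses an action in $\{\text{Bid},\text{No Bid}\}$. Each time a player plays Bid she immediately pays $c$ to the seller. If exactly one active player bids in a round, she wins the object (receiving value $v$), pays the sale price $s$, and the game ends. If two or more players bid, the game continues to the next round. If no active player bids, the round is replayed (players resubmit their actions). With re-entry, all $n$ original players are active in every round regardless of history. Without re-entry, the active players in round $t+1$ are exactly those who played Bid in round $t$; $n_t$ denotes the number of active players in round $t$ ($n_1=n$). Players do not discount; each player's payoff is $u$ evaluated at her final wealth, where $u(x)=\frac{1-e^{-\rho x}}{\rho}$ with a constant $\rho<0$ (constant absolute risk-loving utility), or $u(x)=x$ in the risk-neutral case $\rho=0$. A player's wealth at the start of round $t$ is her initial wealth plus all gains minus all fees paid so far. A (behavioral) strategy maps each history to a probability of playing Bid; a symmetric subgame perfect equilibrium is a subgame perfect equilibrium in which all players use the same strategy. *)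

theory Defs
  imports "HOL-Probability.Probability"
begin

text \<open>Pay-to-bid game. Players are 0,...,n-1. A stage (one simultaneous submission of
actions) is recorded by the set of players who played Bid. A history is the list of
stages played so far, in chronological order; a stage with no bidder is a replay
(it is observed and recorded, but does not change the active set).
The flag re is True for the version with re-entry, False without re-entry.\<close>

text \<open>CARA utility; rho < 0 risk loving, rho = 0 risk neutral.\<close>
definition u :: "real \<Rightarrow> real \<Rightarrow> real" where
  "u \<rho> x = (if \<rho> = 0 then x else (1 - exp (- \<rho> * x)) / \<rho>)"

text \<open>Utility of final wealth minus infinity (player paid infinitely many fees):
the limit of u at minus infinity.\<close>
definition u_minf :: "real \<Rightarrow> ereal" where
  "u_minf \<rho> = (if \<rho> = 0 then - \<infinity> else ereal (1 / \<rho>))"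

definition next_active :: "bool \<Rightarrow> nat set \<Rightarrow> nat set \<Rightarrow> nat set" where
  "next_active re A B = (if re \<or> B = {} then A else B)"

definition active :: "bool \<Rightarrow> nat \<Rightarrow> nat set list \<Rightarrow> nat set" where
  "active re n h = foldl (next_active re) {..<n} h"

definition terminal :: "nat set list \<Rightarrow> bool" where
  "terminal h = (\<exists>B \<in> set h. card B = 1)"

definition valid :: "bool \<Rightarrow> nat \<Rightarrow> nat set list \<Rightarrow> bool" where
  "valid re n h = (\<forall>k < length h. h ! k \<subseteq> active re n (take k h) \<and> \<not> terminal (take k h))"

definition nbids :: "nat \<Rightarrow> nat set list \<Rightarrow> nat" where
  "nbids i h = card {k. k < length h \<and> i \<in> h ! k}"

definition wealth :: "real \<Rightarrow> (nat \<Rightarrow> real) \<Rightarrow> nat \<Rightarrow> nat set list \<Rightarrow> real" where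
  "wealth c w0 i h = w0 i - c * real (nbids i h)"

text \<open>Behavioral strategy: history \<mapsto> probability of Bid.\<close>
definition is_strategy :: "(nat set list \<Rightarrow> real) \<Rightarrow> bool" where
  "is_strategy \<sigma> = (\<forall>h. 0 \<le> \<sigma> h \<and> \<sigma> h \<le> 1)"

text \<open>Randomization device: at stage k of the subgame, player i plays Bid iff
omega (k,i) < (her probability of Bid), where the omega (k,i) are independent
uniform on [0,1]. This realises the distribution of play induced by the
behavioral strategy profile P (P i = strategy of player i).\<close>
definition dev :: "(nat \<times> nat \<Rightarrow> real) measure" where
  "dev = Pi\<^sub>M UNIV (\<lambda>_. uniform_measure lborel {0..1::real})"

primrec run :: "bool \<Rightarrow> nat \<Rightarrow> (nat \<Rightarrow> nat set list \<Rightarrow> real) \<Rightarrow> nat set list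
    \<Rightarrow> (nat \<times> nat \<Rightarrow> real) \<Rightarrow> nat \<Rightarrow> nat set list" where
  "run re n P h \<omega> 0 = h"
| "run re n P h \<omega> (Suc k) =
     (let g = run re n P h \<omega> k in
      if terminal g then g
      else g @ [{i \<in> active re n g. \<omega> (k, i) < P i g}])"

definition total_bids :: "bool \<Rightarrow> nat \<Rightarrow> (nat \<Rightarrow> nat set list \<Rightarrow> real) \<Rightarrow> nat set list
    \<Rightarrow> (nat \<times> nat \<Rightarrow> real) \<Rightarrow> nat \<Rightarrow> enat" where
  "total_bids re n P h \<omega> i = (SUP k. enat (nbids i (run re n P h \<omega> k)))"

definition wins :: "bool \<Rightarrow> nat \<Rightarrow> (nat \<Rightarrow> nat set list \<Rightarrow> real) \<Rightarrow> nat set list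
    \<Rightarrow> (nat \<times> nat \<Rightarrow> real) \<Rightarrow> nat \<Rightarrow> bool" where
  "wins re n P h \<omega> i = (\<exists>k. {i} \<in> set (run re n P h \<omega> k))"

definition play_util :: "bool \<Rightarrow> nat \<Rightarrow> real \<Rightarrow> real \<Rightarrow> real \<Rightarrow> real \<Rightarrow> (nat \<Rightarrow> real)
    \<Rightarrow> (nat \<Rightarrow> nat set list \<Rightarrow> real) \<Rightarrow> nat set list \<Rightarrow> nat \<Rightarrow> (nat \<times> nat \<Rightarrow> real) \<Rightarrow> ereal" where
  "play_util re n v c s \<rho> w0 P h i \<omega> =
     (case total_bids re n P h \<omega> i of
        \<infinity> \<Rightarrow> u_minf \<rho>
      | enat m \<Rightarrow> ereal (u \<rho> (w0 i - c * real m
                              + (if wins re n P h \<omega> i then v - s else 0))))"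

text \<open>Expectation of a random variable X bounded above by B:
E[X] = B - E[B - X] (the latter a nonnegative integral, possibly infinite).\<close>
definition expect_above :: "'a measure \<Rightarrow> real \<Rightarrow> ('a \<Rightarrow> ereal) \<Rightarrow> ereal" where
  "expect_above M B X = ereal B - enn2ereal (\<integral>\<^sup>+ x. e2ennreal (ereal B - X x) \<partial>M)"

text \<open>Expected utility of player i in the subgame starting at history h under profile P.
The bound u(w0 i + v - s) dominates every final-wealth utility of player i.\<close>
definition EU :: "bool \<Rightarrow> nat \<Rightarrow> real \<Rightarrow> real \<Rightarrow> real \<Rightarrow> real \<Rightarrow> (nat \<Rightarrow> real)
    \<Rightarrow> (nat \<Rightarrow> nat set list \<Rightarrow> real) \<Rightarrow> nat \<Rightarrow> nat set list \<Rightarrow> ereal" where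
  "EU re n v c s \<rho> w0 P i h =
     expect_above dev (u \<rho> (w0 i + v - s)) (play_util re n v c s \<rho> w0 P h i)"

definition SSPE :: "bool \<Rightarrow> nat \<Rightarrow> real \<Rightarrow> real \<Rightarrow> real \<Rightarrow> real \<Rightarrow> (nat \<Rightarrow> real)
    \<Rightarrow> (nat set list \<Rightarrow> real) \<Rightarrow> bool" where
  "SSPE re n v c s \<rho> w0 \<sigma> =
     (is_strategy \<sigma> \<and>
      (\<forall>h i \<tau>. valid re n h \<and> \<not> terminal h \<and> i < n \<and> is_strategy \<tau> \<longrightarrow>
         EU re n v c s \<rho> w0 ((\<lambda>_. \<sigma>)(i := \<tau>)) i h \<le> EU re n v c s \<rho> w0 (\<lambda>_. \<sigma>) i h))"

definition bid_prob :: "real \<Rightarrow> real \<Rightarrow> real \<Rightarrow> real \<Rightarrow> nat \<Rightarrow> real" where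
  "bid_prob \<rho> v c s m = 1 - (u \<rho> c / u \<rho> (v - s)) powr (1 / (real m - 1))"

end

theory Submission
  imports Defs
begin

text \<open>
  Constant absolute risk aversion lets one measure a continuation value by its \<^emph>\<open>gain\<close> over the
  utility of current wealth, rescaled so that wealth drops out of the one-stage recursion.

  In a symmetric equilibrium gains are nonnegative, since a player may stop bidding. At most one
  player wins, so of two active players one has a gain of at most half the best possible
  \<open>u (v - s - c)\<close>; bidding must not be better for her, which bounds the bidding probability away
  from 0 uniformly over histories. If moreover all gains are at most \<open>M\<close>, then they are at most
  \<open>\<theta> M\<close> for a fixed \<open>\<theta> < 1\<close>: when others bid almost surely, a bid costs \<open>c\<close> and leaves at most \<open>M\<close>;
  otherwise not bidding is optimal, and with probability bounded below a single opponent bids and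
  ends the game. Hence all gains vanish, and indifference determines the bidding probability.

  Conversely, if the others bid with this probability, the utility of current wealth is a
  martingale whatever player \<open>i\<close> does. It converges pointwise to her payoff, including on plays with
  infinitely many fees, and expectations converge too because in each stage the game ends with
  probability bounded below. So every strategy of player \<open>i\<close> yields exactly the utility of her
  current wealth.
\<close>

section \<open>The first stage of a subgame\<close>

text \<open>The random set of bidders in the first stage at \<open>h\<close>. It reads only row 0 of
  \<open>\<omega>\<close>, and the rest of the play reads the later rows.\<close>

definition bids :: "bool \<Rightarrow> nat \<Rightarrow> (nat \<Rightarrow> nat set list \<Rightarrow> real) \<Rightarrow> nat set list
    \<Rightarrow> (nat \<times> nat \<Rightarrow> real) \<Rightarrow> nat set" where
  "bids re n P h \<omega> = {i \<in> active re n h. \<omega> (0, i) < P i h}"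

text \<open>\<open>run\<close> counts stages from the start of the subgame, so the continuation
  after one stage needs its rows renumbered from 0.\<close>

definition drop_row :: "(nat \<times> nat \<Rightarrow> real) \<Rightarrow> nat \<times> nat \<Rightarrow> real" where
  "drop_row \<omega> = (\<lambda>(k, i). \<omega> (Suc k, i))"

text \<open>Combines two independent samples into one: the first supplies the randomness of the
  first stage, the second that of the continuation.\<close>

definition prepend_row :: "(nat \<times> nat \<Rightarrow> real) \<Rightarrow> (nat \<times> nat \<Rightarrow> real) \<Rightarrow> nat \<times> nat \<Rightarrow> real" where
  "prepend_row x y = (\<lambda>(k, i). if k = 0 then x (0, i) else y (k - 1, i))"

definition bid_set_prob :: "bool \<Rightarrow> nat \<Rightarrow> (nat \<Rightarrow> nat set list \<Rightarrow> real) \<Rightarrow> nat set list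
    \<Rightarrow> nat set \<Rightarrow> real" where
  "bid_set_prob re n P h B = (\<Prod>i\<in>active re n h. if i \<in> B then P i h else 1 - P i h)"

lemma run_terminal: "terminal h \<Longrightarrow> run re n P h \<omega> k = h"
  by (induction k) (auto simp: Let_def)

text \<open>The recursion of \<open>run\<close> appends the last stage; splitting off the first one
  instead expresses a subgame through its continuations.\<close>

lemma run_Suc_drop_row:
  "\<not> terminal h \<Longrightarrow> run re n P h \<omega> (Suc k) = run re n P (h @ [bids re n P h \<omega>]) (drop_row \<omega>) k"
proof (induction k)
  case 0 then show ?case by (simp add: bids_def)
next
  case (Suc k)
  show ?case
    by (subst run.simps(2), subst Suc.IH[OF Suc.prems], subst run.simps(2))
      (simp add: Let_def drop_row_def)
qed

section \<open>The independent uniform variables behind mixed play\<close>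

lemma prob_space_uniform_01: "prob_space (uniform_measure lborel {0..1::real})"
  by (intro prob_space_uniform_measure) auto

interpretation dev: product_prob_space "\<lambda>_::nat \<times> nat. uniform_measure lborel {0..1::real}" UNIV
  by (intro product_prob_space.intro product_sigma_finite.intro
      product_prob_space_axioms.intro prob_space_uniform_01
      prob_space_imp_sigma_finite)

lemma prob_space_dev: "prob_space dev"
  unfolding dev_def by (rule dev.P.prob_space_axioms)

lemma space_dev [simp]: "space dev = UNIV"
  by (simp add: dev_def space_PiM)

lemma sets_dev: "sets dev = sets (Pi\<^sub>M UNIV (\<lambda>_. borel))"
  unfolding dev_def by (intro sets_PiM_cong) auto

lemma measurable_dev_component [measurable]: "(\<lambda>\<omega>. \<omega> j) \<in> borel_measurable dev"
  unfolding measurable_cong_sets[OF sets_dev refl] by measurable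

lemma measurable_to_dev:
  assumes "\<And>j. (\<lambda>x. f x j) \<in> borel_measurable M"
  shows "f \<in> measurable M dev"
  unfolding measurable_cong_sets[OF refl sets_dev]
  by (rule measurable_PiM_single') (use assms in auto)

lemma measurable_drop_row [measurable]: "drop_row \<in> measurable dev dev"
  by (rule measurable_to_dev) (auto simp: drop_row_def split: prod.split)

lemma measurable_prepend_row [measurable]:
  "(\<lambda>(x, y). prepend_row x y) \<in> measurable (dev \<Otimes>\<^sub>M dev) dev"
proof (rule measurable_to_dev)
  fix j :: "nat \<times> nat"
  obtain k i where "j = (k, i)" by (cases j)
  then show "(\<lambda>x. (case x of (x, y) \<Rightarrow> prepend_row x y) j) \<in> borel_measurable (dev \<Otimes>\<^sub>M dev)"
    by (cases "k = 0") (simp_all add: prepend_row_def split_beta')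
qed

text \<open>A product measure is determined by its values on finite-dimensional cylinders. The
  preimage of a cylinder splits into one that constrains row 0 of the first sample and one that
  constrains the second sample, and the two products multiply to the product over
  \<open>J\<close>.\<close>

lemma distr_prepend_row: "distr (dev \<Otimes>\<^sub>M dev) dev (\<lambda>(x, y). prepend_row x y) = dev"
proof -
  let ?M = "\<lambda>_::nat \<times> nat. uniform_measure lborel {0..1::real}"
  let ?f = "\<lambda>(x, y). prepend_row x y"
  let ?D = "distr (dev \<Otimes>\<^sub>M dev) dev ?f"
  let ?s = "\<lambda>(k, i). (Suc k, i) :: nat \<times> nat"
  interpret d: prob_space dev by (rule prob_space_dev)
  have "?D = PiM UNIV ?M"
  proof (rule dev.PiM_eq)
    show "sets ?D = sets (PiM UNIV ?M)" by (simp add: dev_def)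
  next
    fix J and E :: "nat \<times> nat \<Rightarrow> real set"
    assume J: "finite J" "J \<subseteq> UNIV" "\<And>j. j \<in> J \<Longrightarrow> E j \<in> sets (?M j)"
    let ?X = "prod_emb UNIV ?M J (\<Pi>\<^sub>E j\<in>J. E j)"
    \<comment> \<open>\<open>?J0\<close> holds the coordinates of \<open>J\<close> in row 0;
      \<open>?J1\<close> holds those in later rows, with the row index lowered by one to address the
      second sample.\<close>
    let ?J0 = "J \<inter> {0} \<times> UNIV" and ?J1 = "?s -` J"
    let ?E = "prod_emb UNIV ?M ?J0 (\<Pi>\<^sub>E j\<in>?J0. E j)"
    let ?F = "prod_emb UNIV ?M ?J1 (\<Pi>\<^sub>E j\<in>?J1. E (?s j))"
    have inj: "inj ?s" by (auto simp: inj_on_def)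
    have fin: "finite ?J1" by (intro finite_vimageI J inj)
    have "?f -` ?X = ?E \<times> ?F"
    proof (intro set_eqI, clarify)
      fix x y :: "nat \<times> nat \<Rightarrow> real"
      have "(\<forall>j\<in>J. prepend_row x y j \<in> E j) \<longleftrightarrow>
          (\<forall>j\<in>?J0. x j \<in> E j) \<and> (\<forall>j\<in>?J1. y j \<in> E (?s j))" (is "?L \<longleftrightarrow> ?R")
      proof
        assume L: ?L
        have "x (0, i) \<in> E (0, i)" if "(0, i) \<in> J" for i
          using L that by (auto simp: prepend_row_def dest!: bspec)
        moreover have "y (k, i) \<in> E (Suc k, i)" if "(Suc k, i) \<in> J" for k i
          using L that by (auto simp: prepend_row_def dest!: bspec)
        ultimately show ?R by auto
      next
        assume R: ?R
        show ?L
        proof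
          fix j assume "j \<in> J"
          moreover obtain k i where "j = (k, i)" by (cases j)
          ultimately show "prepend_row x y j \<in> E j"
            using R by (cases k) (auto simp: prepend_row_def dest!: bspec[of "?J1" _ "(k - 1, i)"])
        qed
      qed
      then show "(x, y) \<in> ?f -` ?X \<longleftrightarrow> (x, y) \<in> ?E \<times> ?F"
        by (simp add: prod_emb_def Pi_iff)
    qed
    moreover have "?X \<in> sets dev"
      unfolding dev_def using J by (intro sets_PiM_I) auto
    ultimately have "emeasure ?D ?X = emeasure (dev \<Otimes>\<^sub>M dev) (?E \<times> ?F)"
      by (subst emeasure_distr) (auto simp: space_pair_measure)
    also have "\<dots> = emeasure dev ?E * emeasure dev ?F"
      using J fin
      by (intro d.emeasure_pair_measure_Times) (auto simp: dev_def intro!: sets_PiM_I)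
    also have "emeasure dev ?F = (\<Prod>j\<in>?J1. emeasure (?M j) (E (?s j)))"
      unfolding dev_def using J fin by (intro dev.emeasure_PiM_emb) auto
    also have "\<dots> = (\<Prod>j\<in>?s ` ?J1. emeasure (?M j) (E j))"
      using inj by (subst prod.reindex) (auto simp: inj_on_def)
    also have "?s ` ?J1 = J - ?J0"
    proof (intro set_eqI iffI)
      fix j assume "j \<in> J - ?J0"
      then show "j \<in> ?s ` ?J1"
        by (cases j; cases "fst j") (auto simp: image_iff)
    qed auto
    also have "emeasure dev ?E = (\<Prod>j\<in>?J0. emeasure (?M j) (E j))"
      unfolding dev_def using J by (intro dev.emeasure_PiM_emb) auto
    also have "(\<Prod>j\<in>?J0. emeasure (?M j) (E j)) * (\<Prod>j\<in>J - ?J0. emeasure (?M j) (E j))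
        = (\<Prod>j\<in>J. emeasure (?M j) (E j))"
      using J by (subst mult.commute) (auto simp: prod.subset_diff[symmetric])
    finally show "emeasure ?D ?X = (\<Prod>j\<in>J. emeasure (?M j) (E j))" .
  qed
  then show ?thesis by (simp add: dev_def)
qed

lemma drop_row_prepend_row [simp]: "drop_row (prepend_row x y) = y"
  by (auto simp: drop_row_def prepend_row_def)

lemma bids_prepend_row [simp]: "bids re n P h (prepend_row x y) = bids re n P h x"
  by (simp add: bids_def prepend_row_def)

section \<open>Distribution of the first set of bidders\<close>

lemma bids_subset: "bids re n P h \<omega> \<subseteq> active re n h"
  by (auto simp: bids_def)

lemma bids_eq_iff:
  "B \<subseteq> active re n h \<Longrightarrow>
    bids re n P h \<omega> = B \<longleftrightarrow> (\<forall>i\<in>active re n h. \<omega> (0, i) < P i h \<longleftrightarrow> i \<in> B)"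
  by (auto simp: bids_def)

lemma measurable_bids [measurable]:
  assumes "finite (active re n h)"
  shows "bids re n P h \<in> measurable dev (count_space (Pow (active re n h)))"
proof (subst measurable_count_space_eq2)
  show "finite (Pow (active re n h))" using assms by simp
  have "bids re n P h -` {B} \<in> sets dev" if "B \<subseteq> active re n h" for B
  proof -
    have "bids re n P h -` {B} =
        {\<omega> \<in> space dev. \<forall>i\<in>active re n h. \<omega> (0, i) < P i h \<longleftrightarrow> i \<in> B}"
      using bids_eq_iff[OF that] by auto
    also have "\<dots> \<in> sets dev"
      using assms by measurable
    finally show ?thesis .
  qed
  then show "bids re n P h \<in> space dev \<rightarrow> Pow (active re n h) \<and>
      (\<forall>B\<in>Pow (active re n h). bids re n P h -` {B} \<inter> space dev \<in> sets dev)"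
    using bids_subset by auto
qed

lemma emeasure_uniform_01:
  assumes "0 \<le> p" "p \<le> 1"
  shows "emeasure (uniform_measure lborel {0..1::real}) {..<p} = ennreal p"
    and "emeasure (uniform_measure lborel {0..1::real}) {p..} = ennreal (1 - p)"
proof -
  have 1: "{0..1} \<inter> {..<p} = {0..<p}" "{0..1} \<inter> {p..} = {p..1}" using assms by auto
  show "emeasure (uniform_measure lborel {0..1::real}) {..<p} = ennreal p"
    "emeasure (uniform_measure lborel {0..1::real}) {p..} = ennreal (1 - p)"
    using assms by (simp_all add: 1 divide_ennreal flip: ennreal_1)
qed

text \<open>The event is a box in row 0: the coordinate of a bidder lies below her bidding
  probability, that of another active player at or above it. Independence turns its measure into a
  product.\<close>

lemma emeasure_bids:
  assumes P: "\<And>i. is_strategy (P i)" and fin: "finite (active re n h)"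
    and B: "B \<subseteq> active re n h"
  shows "emeasure dev {\<omega>. bids re n P h \<omega> = B} = ennreal (bid_set_prob re n P h B)"
proof -
  let ?A = "active re n h"
  let ?M = "\<lambda>_::nat \<times> nat. uniform_measure lborel {0..1::real}"
  let ?X = "\<lambda>j::nat \<times> nat. if snd j \<in> B then {..<P (snd j) h} else {P (snd j) h..}"
  have P01: "0 \<le> P i h" "P i h \<le> 1" for i using P[of i] by (auto simp: is_strategy_def)
  have "{\<omega>. bids re n P h \<omega> = B} = {\<omega>\<in>space (Pi\<^sub>M UNIV ?M). \<forall>j\<in>{0} \<times> ?A. \<omega> j \<in> ?X j}"
  proof -
    have "(x < y \<longleftrightarrow> i \<in> B) \<longleftrightarrow> (i \<in> B \<longrightarrow> x < y) \<and> (i \<notin> B \<longrightarrow> y \<le> x)" for x y :: real and i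
      by auto
    then show ?thesis
      unfolding bids_eq_iff[OF B] by (simp add: space_PiM)
  qed
  then have "emeasure dev {\<omega>. bids re n P h \<omega> = B} = (\<Prod>j\<in>{0} \<times> ?A. emeasure (?M j) (?X j))"
    unfolding dev_def using fin by (simp only:, intro dev.emeasure_PiM_Collect) auto
  also have "\<dots> = (\<Prod>i\<in>?A. emeasure (?M (0, i)) (?X (0, i)))"
    by (rule prod.reindex_cong[of "\<lambda>i. (0, i)"]) (auto simp: inj_on_def)
  also have "\<dots> = (\<Prod>i\<in>?A. ennreal (if i \<in> B then P i h else 1 - P i h))"
    by (intro prod.cong) (simp_all add: emeasure_uniform_01 P01 del: emeasure_uniform_measure)
  also have "\<dots> = ennreal (bid_set_prob re n P h B)"
    unfolding bid_set_prob_def by (intro prod_ennreal) (auto simp: P01)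
  finally show ?thesis .
qed

text \<open>The law of total expectation for one stage. After replacing \<open>dev\<close> by the
  image of two independent copies, the bidders depend on one copy and the continuation on the other,
  so that iterated integration and a finite sum over the sets of bidders suffice.\<close>

lemma nn_integral_first_stage:
  assumes P: "\<And>i. is_strategy (P i)" and fin: "finite (active re n h)"
    and G: "\<And>B. B \<subseteq> active re n h \<Longrightarrow> G B \<in> borel_measurable dev"
  shows "(\<integral>\<^sup>+\<omega>. G (bids re n P h \<omega>) (drop_row \<omega>) \<partial>dev) =
    (\<Sum>B\<in>Pow (active re n h). ennreal (bid_set_prob re n P h B) * (\<integral>\<^sup>+\<omega>. G B \<omega> \<partial>dev))"
proof -
  let ?A = "active re n h" and ?b = "bids re n P h"
  interpret d: prob_space dev by (rule prob_space_dev)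
  have [measurable]: "?b \<in> measurable dev (count_space (Pow ?A))"
    by (rule measurable_bids[OF fin])
  have cnt: "countable (Pow ?A)" using fin by (simp add: countable_finite)
  have meas: "(\<lambda>\<omega>. G (?b \<omega>) (drop_row \<omega>)) \<in> borel_measurable dev"
    by (rule measurable_compose_countable'[where I = "Pow ?A"
          and f = "\<lambda>B \<omega>. G B (drop_row \<omega>)", OF _ _ cnt])
      (auto intro: measurable_compose[OF measurable_drop_row G] measurable_bids[OF fin])
  have "(\<integral>\<^sup>+\<omega>. G (?b \<omega>) (drop_row \<omega>) \<partial>dev) =
      (\<integral>\<^sup>+z. G (?b (fst z)) (snd z) \<partial>(dev \<Otimes>\<^sub>M dev))"
    by (subst distr_prepend_row[symmetric], subst nn_integral_distr)
      (use meas in \<open>auto simp: split_beta'\<close>)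
  also have "\<dots> = (\<integral>\<^sup>+x. \<integral>\<^sup>+y. G (?b x) y \<partial>dev \<partial>dev)"
  proof -
    have "(\<lambda>z. G (?b (fst z)) (snd z)) \<in> borel_measurable (dev \<Otimes>\<^sub>M dev)"
      by (rule measurable_compose_countable'[where I = "Pow ?A" and f = "\<lambda>B z. G B (snd z)", OF _ _ cnt])
        (auto intro: measurable_compose[OF measurable_snd G])
    from d.nn_integral_fst[OF this] show ?thesis by simp
  qed
  also have "\<dots> = (\<integral>\<^sup>+x. (\<Sum>B\<in>Pow ?A. (\<integral>\<^sup>+y. G B y \<partial>dev) * indicator {\<omega>. ?b \<omega> = B} x) \<partial>dev)"
  proof (intro nn_integral_cong)
    fix x
    have "(\<Sum>B\<in>Pow ?A. (\<integral>\<^sup>+y. G B y \<partial>dev) * indicator {\<omega>. ?b \<omega> = B} x) =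
        (\<Sum>B\<in>Pow ?A. if B = ?b x then (\<integral>\<^sup>+y. G B y \<partial>dev) else 0)"
      by (intro sum.cong) (auto simp: indicator_def)
    also have "\<dots> = (\<integral>\<^sup>+y. G (?b x) y \<partial>dev)"
      using fin bids_subset[of re n P h x] by (subst sum.delta) auto
    finally show "(\<integral>\<^sup>+y. G (?b x) y \<partial>dev) =
        (\<Sum>B\<in>Pow ?A. (\<integral>\<^sup>+y. G B y \<partial>dev) * indicator {\<omega>. ?b \<omega> = B} x)" ..
  qed
  also have "\<dots> = (\<Sum>B\<in>Pow ?A. (\<integral>\<^sup>+y. G B y \<partial>dev) * emeasure dev {\<omega>. ?b \<omega> = B})"
  proof -
    have s: "{\<omega>. ?b \<omega> = B} \<in> sets dev" if "B \<subseteq> ?A" for B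
    proof -
      have "?b -` {B} \<inter> space dev \<in> sets dev"
        using that by (intro measurable_sets[OF measurable_bids[OF fin]]) auto
      also have "?b -` {B} \<inter> space dev = {\<omega>. ?b \<omega> = B}" by auto
      finally show ?thesis .
    qed
    then show ?thesis
      by (subst nn_integral_sum) (auto intro!: sum.cong nn_integral_cmult_indicator)
  qed
  also have "\<dots> = (\<Sum>B\<in>Pow ?A. ennreal (bid_set_prob re n P h B) * (\<integral>\<^sup>+\<omega>. G B \<omega> \<partial>dev))"
    by (intro sum.cong) (auto simp: emeasure_bids[where P = P, OF P fin] mult.commute)
  finally show ?thesis .
qed

section \<open>Utility, histories and plays\<close>

lemma u_0 [simp]: "u \<rho> 0 = 0"
  by (simp add: u_def)

text \<open>This identity is constant absolute risk aversion: adding wealth \<open>x\<close> acts on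
  utility as an increasing affine map, so preferences over gambles do not depend on wealth.\<close>

lemma u_add: "u \<rho> (x + y) = u \<rho> x + exp (- \<rho> * x) * u \<rho> y"
proof (cases "\<rho> = 0")
  case False
  have "exp (- \<rho> * (x + y)) = exp (- \<rho> * x) * exp (- \<rho> * y)"
    by (simp add: exp_add[symmetric] algebra_simps)
  then show ?thesis using False by (simp add: u_def divide_simps) (simp add: algebra_simps)
qed (simp add: u_def)

lemma u_strict_mono: "x < y \<Longrightarrow> u \<rho> x < u \<rho> y"
proof -
  assume "x < y"
  then consider "\<rho> = 0" | "\<rho> < 0" "- \<rho> * x < - \<rho> * y" | "\<rho> > 0" "- \<rho> * y < - \<rho> * x"
    by (cases "\<rho> = 0"; cases "\<rho> < 0") auto
  then show ?thesis
    by cases (use \<open>x < y\<close> in \<open>auto simp: u_def divide_strict_right_mono divide_strict_right_mono_neg\<close>)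
qed

lemma u_mono: "x \<le> y \<Longrightarrow> u \<rho> x \<le> u \<rho> y"
  using u_strict_mono[of x y \<rho>] by (cases "x = y") auto

text \<open>For \<open>\<rho> \<le> 0\<close> the function is convex and lies above its tangent at
  0. Later this lets accumulated fees enter an estimate only linearly.\<close>

lemma u_ge_self: "\<rho> \<le> 0 \<Longrightarrow> x \<le> u \<rho> x"
proof (cases "\<rho> = 0")
  case False
  assume "\<rho> \<le> 0"
  with False have "\<rho> < 0" by simp
  moreover have "1 - exp (- \<rho> * x) \<le> \<rho> * x" using exp_ge_add_one_self[of "- \<rho> * x"] by simp
  ultimately show ?thesis using False by (simp add: u_def field_simps)
qed (simp add: u_def)

section \<open>Histories and active players\<close>

lemma terminal_snoc [simp]: "terminal (h @ [B]) \<longleftrightarrow> terminal h \<or> card B = 1"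
  by (auto simp: terminal_def)

lemma active_snoc: "active re n (h @ [B]) = next_active re (active re n h) B"
  by (simp add: active_def)

lemma valid_snoc [simp]:
  "valid re n (h @ [B]) \<longleftrightarrow> valid re n h \<and> B \<subseteq> active re n h \<and> \<not> terminal h"
  by (auto simp: valid_def nth_append less_Suc_eq)

lemma active_subset: "valid re n h \<Longrightarrow> active re n h \<subseteq> {..<n}"
  by (induction h rule: rev_induct) (auto simp: active_snoc next_active_def, auto simp: active_def)

lemma finite_active: "valid re n h \<Longrightarrow> finite (active re n h)"
  by (rule finite_subset[OF active_subset]) auto

lemma card_active_le: "valid re n h \<Longrightarrow> card (active re n h) \<le> n"
  using card_mono[of "{..<n}", OF _ active_subset] by simp

text \<open>A single bidder ends the game and a stage without bidders keeps the active set, so the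
  active set cannot shrink below two players while the game goes on. Hence every active player has
  an opponent.\<close>

lemma card_active_ge2:
  "n \<ge> 2 \<Longrightarrow> valid re n h \<Longrightarrow> \<not> terminal h \<Longrightarrow> card (active re n h) \<ge> 2"
proof (induction h rule: rev_induct)
  case Nil then show ?case by (simp add: active_def)
next
  case (snoc B h)
  then have "finite B" using finite_active[of re n h] finite_subset by auto
  then have "B = {} \<or> card B \<ge> 2"
    using snoc.prems by (cases "card B"; cases "card B - 1") auto
  with snoc show ?case by (auto simp: active_snoc next_active_def)
qed

lemma active_reentry: "active True n h = {..<n}"
  by (induction h rule: rev_induct) (auto simp: active_def next_active_def)

lemma nbids_append: "nbids i (h @ l) = nbids i h + nbids i l"
proof -
  have "{k. k < length (h @ l) \<and> i \<in> (h @ l) ! k} =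
      {k. k < length h \<and> i \<in> h ! k} \<union> (+) (length h) ` {k. k < length l \<and> i \<in> l ! k}"
    (is "?L = ?R1 \<union> ?R2")
  proof (intro set_eqI iffI)
    fix k assume "k \<in> ?L"
    then show "k \<in> ?R1 \<union> ?R2"
      by (cases "k < length h") (auto simp: nth_append image_iff intro!: exI[of _ "k - length h"])
  qed (auto simp: nth_append)
  moreover have "card (?R1 \<union> ?R2) = card ?R1 + card ?R2"
    by (intro card_Un_disjoint) auto
  moreover have "card ?R2 = card {k. k < length l \<and> i \<in> l ! k}"
    by (intro card_image) auto
  ultimately show ?thesis by (simp only: nbids_def)
qed

lemma nbids_single [simp]: "nbids i [B] = (if i \<in> B then 1 else 0)"
  by (simp add: nbids_def cong: conj_cong)

lemma nbids_pos: "B \<in> set l \<Longrightarrow> i \<in> B \<Longrightarrow> 0 < nbids i l"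
  by (auto simp: nbids_def card_gt_0_iff in_set_conv_nth)

section \<open>Realized plays\<close>

lemma run_extends: "\<exists>l. run re n P h \<omega> k = h @ l"
  by (induction k) (auto simp: Let_def)

lemma run_Suc_extends: "\<exists>l. run re n P h \<omega> (Suc k) = run re n P h \<omega> k @ l"
  by (auto simp: Let_def)

lemma run_mono: "k \<le> k' \<Longrightarrow> \<exists>l. run re n P h \<omega> k' = run re n P h \<omega> k @ l"
proof (induction k' rule: dec_induct)
  case (step m)
  then show ?case using run_Suc_extends[of re n P h \<omega> m] by (metis append.assoc)
qed auto

lemma run_stays_terminal:
  "terminal (run re n P h \<omega> k) \<Longrightarrow> k \<le> k' \<Longrightarrow> run re n P h \<omega> k' = run re n P h \<omega> k"
  by (rotate_tac, induction k' rule: dec_induct) (auto simp: Let_def)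

lemma measurable_run:
  "finite (active re n h) \<Longrightarrow> (\<lambda>\<omega>. run re n P h \<omega> k) \<in> measurable dev (count_space UNIV)"
proof (induction k arbitrary: h)
  case (Suc k)
  show ?case
  proof (cases "terminal h")
    case False
    have "(\<lambda>\<omega>. run re n P (h @ [bids re n P h \<omega>]) (drop_row \<omega>) k) \<in> measurable dev (count_space UNIV)"
    proof (rule measurable_compose_countable'[where I = "Pow (active re n h)"
          and f = "\<lambda>B \<omega>. run re n P (h @ [B]) (drop_row \<omega>) k"])
      fix B assume "B \<in> Pow (active re n h)"
      then have "finite (active re n (h @ [B]))"
        using Suc.prems finite_subset by (auto simp: active_snoc next_active_def)
      from measurable_compose[OF measurable_drop_row Suc.IH[OF this]]
      show "(\<lambda>\<omega>. run re n P (h @ [B]) (drop_row \<omega>) k) \<in> measurable dev (count_space UNIV)" .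
    qed (use Suc.prems in \<open>auto intro: countable_finite measurable_bids\<close>)
    then show ?thesis using run_Suc_drop_row[OF False] by simp
  qed (simp add: run_terminal)
qed simp

text \<open>The first stage with a single bidder makes the history terminal, and \<open>run\<close>
  then appends nothing more.\<close>

lemma run_unique_singleton:
  assumes "\<not> terminal h"
  shows "\<exists>B. \<forall>C\<in>set (run re n P h \<omega> k). card C = 1 \<longrightarrow> C = B"
proof (induction k)
  case 0 then show ?case using assms by (auto simp: terminal_def)
next
  case (Suc k)
  then show ?case by (auto simp: Let_def terminal_def)
qed

lemma wins_unique:
  assumes "\<not> terminal h" "wins re n P h \<omega> i" "wins re n P h \<omega> j"
  shows "i = j"
proof -
  from assms obtain k k' where k: "{i} \<in> set (run re n P h \<omega> k)" "{j} \<in> set (run re n P h \<omega> k')"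
    by (auto simp: wins_def)
  have "{i} \<in> set (run re n P h \<omega> (max k k'))" "{j} \<in> set (run re n P h \<omega> (max k k'))"
    using k run_mono[of k "max k k'" re n P h \<omega>] run_mono[of k' "max k k'" re n P h \<omega>]
    by (metis UnCI max.cobounded1 max.cobounded2 set_append)+
  then show ?thesis
    using run_unique_singleton[OF assms(1), of re n P \<omega> "max k k'"] by (metis is_singletonI is_singleton_altdef singleton_inject)
qed

lemma sets_wins:
  assumes "finite (active re n h)"
  shows "{\<omega>. wins re n P h \<omega> i} \<in> sets dev"
proof -
  have "{\<omega>. wins re n P h \<omega> i} =
      (\<Union>k. (\<lambda>\<omega>. run re n P h \<omega> k) -` {g. {i} \<in> set g} \<inter> space dev)"
    by (auto simp: wins_def)
  also have "\<dots> \<in> sets dev"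
    by (intro sets.countable_UN image_subsetI measurable_sets[OF measurable_run[OF assms]]) auto
  finally show ?thesis .
qed

text \<open>The events that different players win are disjoint. This serves to find, among two
  active players, one whose gain is at most half of the best possible.\<close>

lemma sum_prob_wins_le_1:
  assumes fin: "finite (active re n h)" and "\<not> terminal h" and J: "finite J"
  shows "(\<Sum>i\<in>J. measure dev {\<omega>. wins re n P h \<omega> i}) \<le> 1"
proof -
  interpret d: prob_space dev by (rule prob_space_dev)
  have "(\<Sum>i\<in>J. measure dev {\<omega>. wins re n P h \<omega> i}) = measure dev (\<Union>i\<in>J. {\<omega>. wins re n P h \<omega> i})"
    using J sets_wins[OF fin] wins_unique[OF assms(2)]
    by (intro d.finite_measure_finite_Union[symmetric]) (auto simp: disjoint_family_on_def)
  also have "\<dots> \<le> 1" by (rule d.prob_le_1)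
  finally show ?thesis .
qed

lemma not_active_run:
  assumes "i \<notin> active re n h" "valid re n h" "\<not> re"
  shows "i \<notin> active re n (run re n P h \<omega> k) \<and> nbids i (run re n P h \<omega> k) = nbids i h
    \<and> ({i} \<in> set (run re n P h \<omega> k) \<longleftrightarrow> {i} \<in> set h)"
proof (induction k)
  case (Suc k)
  then show ?case using assms
    by (auto simp: Let_def active_snoc next_active_def nbids_append)
qed (use assms in auto)

text \<open>Play from \<open>h\<close> consults strategies only at extensions of \<open>h\<close>.
  In particular a deviation at a single history leaves the play after it unchanged.\<close>

lemma run_cong:
  assumes "\<And>g j. length h \<le> length g \<Longrightarrow> P j g = P' j g"
  shows "run re n P h \<omega> k = run re n P' h \<omega> k"
proof (induction k)
  case (Suc k)
  have "length h \<le> length (run re n P h \<omega> k)" using run_extends[of re n P h \<omega> k] by auto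
  with Suc assms show ?case by (auto simp: Let_def)
qed simp

section \<open>Probabilities of the sets of bidders\<close>

lemma bid_set_prob_nonneg:
  assumes "\<And>i. is_strategy (P i)"
  shows "0 \<le> bid_set_prob re n P h B"
  unfolding bid_set_prob_def using assms by (intro prod_nonneg) (auto simp: is_strategy_def)

text \<open>Expand the product of the factors \<open>f i + (1 - f i)\<close>, each of which is
  1.\<close>

lemma sum_Pow_prod_if_complement:
  fixes f :: "'a \<Rightarrow> 'b::comm_ring_1"
  assumes "finite A"
  shows "(\<Sum>B\<in>Pow A. \<Prod>i\<in>A. if i \<in> B then f i else 1 - f i) = 1"
proof -
  have "(\<Sum>B\<in>Pow A. \<Prod>i\<in>A. if i \<in> B then f i else 1 - f i) =
      (\<Sum>B\<in>Pow A. (\<Prod>i\<in>B. f i) * (\<Prod>i\<in>A - B. 1 - f i))"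
  proof (intro sum.cong refl)
    fix B assume "B \<in> Pow A"
    then have "A \<inter> {i. i \<in> B} = B" "A \<inter> - {i. i \<in> B} = A - B" by auto
    then show "(\<Prod>i\<in>A. if i \<in> B then f i else 1 - f i) = (\<Prod>i\<in>B. f i) * (\<Prod>i\<in>A - B. 1 - f i)"
      using assms by (simp add: prod.If_cases)
  qed
  also have "\<dots> = (\<Prod>i\<in>A. f i + (1 - f i))" by (rule prod_add[OF assms, symmetric])
  finally show ?thesis by simp
qed

lemma sum_bid_set_prob:
  assumes "finite (active re n h)"
  shows "(\<Sum>B\<in>Pow (active re n h). bid_set_prob re n P h B) = 1"
  unfolding bid_set_prob_def by (rule sum_Pow_prod_if_complement[OF assms])

section \<open>Expected loss\<close>

text \<open>Makes the payoff of a play with infinitely many fees a limit of payoffs along that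
  play.\<close>

lemma u_tendsto_u_minf:
  assumes "\<rho> \<le> 0" "filterlim f at_bot F"
  shows "((\<lambda>x. ereal (u \<rho> (f x))) \<longlongrightarrow> u_minf \<rho>) F"
proof (cases "\<rho> = 0")
  case True
  then show ?thesis
    using assms(2) by (simp add: u_def u_minf_def tendsto_MInfty filterlim_at_bot_dense)
next
  case False
  with assms have "\<rho> < 0" by simp
  then have "filterlim (\<lambda>x. - \<rho> * f x) at_bot F"
    using assms(2) by (intro filterlim_tendsto_pos_mult_at_bot[OF tendsto_const]) auto
  then have "((\<lambda>x. exp (- \<rho> * f x)) \<longlongrightarrow> 0) F"
    by (rule filterlim_compose[OF exp_at_bot])
  then have "((\<lambda>x. (1 - exp (- \<rho> * f x)) / \<rho>) \<longlongrightarrow> (1 - 0) / \<rho>) F"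
    using False by (intro tendsto_intros)
  with False show ?thesis by (simp add: u_def u_minf_def)
qed

locale pay_to_bid =
  fixes re :: bool and n :: nat and v c s \<rho> :: real and w0 :: "nat \<Rightarrow> real"
  assumes n_ge_2: "n \<ge> 2" and c_pos: "c > 0" and c_less: "c < v - s" and rho: "\<rho> \<le> 0"
begin

text \<open>The utility of winning without having paid any fee, which is the bound that
  \<open>EU\<close> uses.\<close>

definition bd :: "nat \<Rightarrow> real" where
  "bd i = u \<rho> (w0 i + v - s)"

text \<open>The utility of player \<open>i\<close> if play stopped at \<open>g\<close>, the prize
  included if she has won. Expected utilities are compared with this potential, and it is the
  martingale of the converse direction.\<close>

definition pot :: "nat \<Rightarrow> nat set list \<Rightarrow> real" where
  "pot i g = u \<rho> (wealth c w0 i g + (if {i} \<in> set g then v - s else 0))"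

text \<open>The shortfall below the bound used in \<open>EU\<close>; unlike payoffs, it can be integrated and
  decomposed in \<open>ennreal\<close> even when it is infinite.\<close>
definition path_loss :: "(nat \<Rightarrow> nat set list \<Rightarrow> real) \<Rightarrow> nat \<Rightarrow> nat set list
    \<Rightarrow> (nat \<times> nat \<Rightarrow> real) \<Rightarrow> ennreal" where
  "path_loss P i h \<omega> = e2ennreal (ereal (bd i) - play_util re n v c s \<rho> w0 P h i \<omega>)"

definition loss :: "(nat \<Rightarrow> nat set list \<Rightarrow> real) \<Rightarrow> nat \<Rightarrow> nat set list \<Rightarrow> ennreal" where
  "loss P i h = (\<integral>\<^sup>+\<omega>. path_loss P i h \<omega> \<partial>dev)"

lemma EU_eq: "EU re n v c s \<rho> w0 P i h = ereal (bd i) - enn2ereal (loss P i h)"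
  by (simp add: EU_def expect_above_def loss_def path_loss_def bd_def)

lemma EU_le_iff:
  "EU re n v c s \<rho> w0 P i h \<le> EU re n v c s \<rho> w0 P' i h \<longleftrightarrow> loss P' i h \<le> loss P i h"
proof -
  have "ereal a - x \<le> ereal a - y \<longleftrightarrow> y \<le> x" if "0 \<le> x" "0 \<le> y" for a x y
    using that by (cases x; cases y) auto
  then show ?thesis by (simp add: EU_eq less_eq_ennreal.rep_eq)
qed

lemma EU_eq_iff:
  assumes "x \<le> bd i"
  shows "EU re n v c s \<rho> w0 P i h = ereal x \<longleftrightarrow> loss P i h = ennreal (bd i - x)"
  unfolding EU_eq using assms
  by (cases "loss P i h") (auto simp: enn2ereal_ennreal top_ennreal.rep_eq)

lemma nonterminal_no_singleton: "\<not> terminal g \<Longrightarrow> {i} \<notin> set g"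
  by (auto simp: terminal_def)

lemma pot_nonterminal: "\<not> terminal g \<Longrightarrow> pot i g = u \<rho> (wealth c w0 i g)"
  by (simp add: pot_def nonterminal_no_singleton)

lemma pot_le_bd: "pot i g \<le> bd i"
proof -
  have "0 \<le> c * real (nbids i g)" using c_pos by simp
  then have "- (c * real (nbids i g)) \<le> v - s" using c_pos c_less by linarith
  then show ?thesis
    unfolding pot_def bd_def wealth_def using c_pos by (intro u_mono) simp
qed

lemma wealth_snoc: "wealth c w0 i (h @ [B]) = wealth c w0 i h - (if i \<in> B then c else 0)"
  by (simp add: wealth_def nbids_append algebra_simps)

lemma pot_snoc:
  assumes "\<not> terminal h"
  shows "pot i (h @ [B]) =
    (if B = {i} then u \<rho> (wealth c w0 i h - c + (v - s))
     else if i \<in> B then u \<rho> (wealth c w0 i h - c) else pot i h)"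
  using nonterminal_no_singleton[OF assms] by (auto simp: pot_def wealth_snoc)

text \<open>A player who bids finitely often has an eventually constant potential. If she bids
  infinitely often, nobody ever wins and her wealth falls without bound, where \<open>u_minf\<close>
  is the limit of utility. Facts about finite plays thus pass to whole plays.\<close>

lemma path_loss_tendsto:
  "(\<lambda>k. ennreal (bd i - pot i (run re n P h \<omega> k))) \<longlonglongrightarrow> path_loss P i h \<omega>"
proof -
  define R where "R = run re n P h \<omega>"
  have ext: "\<exists>l. R k' = R k @ l" if "k \<le> k'" for k k'
    unfolding R_def by (rule run_mono[OF that])
  have N_mono: "nbids i (R k) \<le> nbids i (R k')" if "k \<le> k'" for k k'
    using ext[OF that] by (auto simp: nbids_append)
  have tot: "total_bids re n P h \<omega> i = (SUP k. enat (nbids i (R k)))"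
    by (simp add: total_bids_def R_def)
  have "(\<lambda>k. ereal (bd i - pot i (R k))) \<longlonglongrightarrow> ereal (bd i) - play_util re n v c s \<rho> w0 P h i \<omega>"
  proof (cases "total_bids re n P h \<omega> i")
    case (enat m)
    \<comment> \<open>A finite supremum of bid counts is attained, so from some stage on no further
      fee is paid.\<close>
    then have fin: "finite (range (\<lambda>k. enat (nbids i (R k))))"
      unfolding tot Sup_enat_def by (auto split: if_splits)
    have "enat m \<in> range (\<lambda>k. enat (nbids i (R k)))"
      using Max_in[OF fin] enat fin unfolding tot Sup_enat_def by (metis UNIV_not_empty image_is_empty)
    then obtain K where K: "nbids i (R K) = m" by auto
    have le: "nbids i (R k) \<le> m" for k
      using SUP_upper[of k UNIV "\<lambda>k. enat (nbids i (R k))"] enat unfolding tot by simp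
    have "\<exists>K'. \<forall>k\<ge>K'. {i} \<in> set (R k) \<longleftrightarrow> wins re n P h \<omega> i"
    proof (cases "wins re n P h \<omega> i")
      case True
      then obtain K' where "{i} \<in> set (R K')" by (auto simp: wins_def R_def)
      then have "\<forall>k\<ge>K'. {i} \<in> set (R k)" using ext[of K'] by fastforce
      with True show ?thesis by auto
    qed (auto simp: wins_def R_def)
    then obtain K' where K': "\<And>k. k \<ge> K' \<Longrightarrow> {i} \<in> set (R k) \<longleftrightarrow> wins re n P h \<omega> i" by auto
    have "ereal (bd i - pot i (R k)) = ereal (bd i) - play_util re n v c s \<rho> w0 P h i \<omega>"
      if "k \<ge> max K K'" for k
    proof -
      have "nbids i (R k) = m" using that K le[of k] N_mono[of K k] by simp
      with K'[of k] that show ?thesis by (simp add: play_util_def enat pot_def wealth_def)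
    qed
    then show ?thesis
      by (intro tendsto_eventually eventually_sequentiallyI)
  next
    case infinity
    have unb: "\<exists>k. m < nbids i (R k)" for m
    proof (rule ccontr)
      assume "\<not> (\<exists>k. m < nbids i (R k))"
      then have "(SUP k. enat (nbids i (R k))) \<le> enat m" by (intro SUP_least) (auto simp: not_less)
      with infinity show False by (simp add: tot)
    qed
    have top: "filterlim (\<lambda>k. nbids i (R k)) at_top sequentially"
      unfolding filterlim_at_top eventually_sequentially
      using unb N_mono by (meson less_imp_le order_trans)
    have nt: "\<not> terminal (R k)" for k
    proof
      assume t: "terminal (R k)"
      have "nbids i (R k') \<le> nbids i (R k)" for k'
        using N_mono[of k' k] run_stays_terminal[of re n P h \<omega> k k'] t
        unfolding R_def by (cases "k' \<le> k") auto
      with unb[of "nbids i (R k)"] show False by (meson not_less)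
    qed
    have "filterlim (\<lambda>k. real (nbids i (R k))) at_top sequentially"
      by (rule filterlim_compose[OF filterlim_real_sequentially top])
    then have "filterlim (\<lambda>k. - w0 i + c * real (nbids i (R k))) at_top sequentially"
      using c_pos
      by (intro filterlim_tendsto_add_at_top[OF tendsto_const]
          filterlim_tendsto_pos_mult_at_top[OF tendsto_const])
    then have "filterlim (\<lambda>k. w0 i - c * real (nbids i (R k))) at_bot sequentially"
      by (simp add: filterlim_uminus_at_bot)
    from u_tendsto_u_minf[OF rho this]
    have "(\<lambda>k. ereal (pot i (R k))) \<longlonglongrightarrow> u_minf \<rho>"
      using nt by (simp add: pot_nonterminal wealth_def)
    from tendsto_diff_ereal_general[OF tendsto_const[of "ereal (bd i)"] this]
    show ?thesis by (simp add: play_util_def infinity)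
  qed
  from tendsto_e2ennrealI[OF this] show ?thesis
    by (simp add: R_def path_loss_def)
qed

lemma measurable_pot_run:
  assumes "finite (active re n h)"
  shows "(\<lambda>\<omega>. ennreal (bd i - pot i (run re n P h \<omega> k))) \<in> borel_measurable dev"
  by (rule measurable_compose[OF measurable_run[OF assms]]) simp

lemma measurable_path_loss:
  assumes "finite (active re n h)"
  shows "path_loss P i h \<in> borel_measurable dev"
  by (rule borel_measurable_LIMSEQ_order[OF path_loss_tendsto measurable_pot_run[OF assms]])

text \<open>Both sides are limits of the same sequence, up to an index shift by one.\<close>

lemma path_loss_step:
  assumes "\<not> terminal h"
  shows "path_loss P i h \<omega> = path_loss P i (h @ [bids re n P h \<omega>]) (drop_row \<omega>)"
proof -
  have "(\<lambda>k. ennreal (bd i - pot i (run re n P h \<omega> (Suc k)))) \<longlonglongrightarrow> path_loss P i h \<omega>"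
    using path_loss_tendsto by (rule LIMSEQ_Suc)
  then have "(\<lambda>k. ennreal (bd i - pot i (run re n P (h @ [bids re n P h \<omega>]) (drop_row \<omega>) k)))
      \<longlonglongrightarrow> path_loss P i h \<omega>"
    unfolding run_Suc_drop_row[OF assms] .
  then show ?thesis using path_loss_tendsto by (rule LIMSEQ_unique)
qed

section \<open>Recursion and bounds for the expected loss\<close>

text \<open>The Bellman equation of a fixed profile, in \<open>ennreal\<close> so that it also
  covers infinite losses.\<close>

lemma loss_step:
  assumes P: "\<And>j. is_strategy (P j)" and h: "valid re n h" "\<not> terminal h"
  shows "loss P i h = (\<Sum>B\<in>Pow (active re n h).
    ennreal (bid_set_prob re n P h B) * loss P i (h @ [B]))"
proof -
  have fin: "finite (active re n h)" by (rule finite_active[OF h(1)])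
  have "path_loss P i (h @ [B]) \<in> borel_measurable dev" if "B \<subseteq> active re n h" for B
    using that h by (intro measurable_path_loss finite_active) simp
  then show ?thesis
    unfolding loss_def path_loss_step[OF h(2)]
    by (rule nn_integral_first_stage[where P = P, OF P fin])
qed

lemma loss_const:
  assumes "\<And>\<omega> k. pot i (run re n P h \<omega> k) = pot i h"
  shows "loss P i h = ennreal (bd i - pot i h)"
proof -
  interpret d: prob_space dev by (rule prob_space_dev)
  have "path_loss P i h \<omega> = ennreal (bd i - pot i h)" for \<omega>
    using path_loss_tendsto[of i P h \<omega>] unfolding assms by (rule LIMSEQ_unique[OF _ tendsto_const])
  then show ?thesis
    using d.emeasure_space_1 by (simp add: loss_def del: space_dev)
qed

lemma loss_terminal: "terminal h \<Longrightarrow> loss P i h = ennreal (bd i - pot i h)"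
  by (rule loss_const) (simp add: run_terminal)

lemma loss_inactive:
  assumes "valid re n h" "i < n" "i \<notin> active re n h"
  shows "loss P i h = ennreal (bd i - pot i h)"
proof (rule loss_const)
  fix \<omega> k
  have "\<not> re" using assms active_reentry[of n h] by (cases re) auto
  then show "pot i (run re n P h \<omega> k) = pot i h"
    using not_active_run[OF assms(3,1), of P \<omega> k] by (simp add: pot_def wealth_def)
qed

lemma loss_cong:
  assumes "\<And>g j. length h \<le> length g \<Longrightarrow> P j g = P' j g"
  shows "loss P i h = loss P' i h"
proof -
  have "path_loss P i h \<omega> = path_loss P' i h \<omega>" for \<omega>
    using path_loss_tendsto[of i P h \<omega>] path_loss_tendsto[of i P' h \<omega>]
      run_cong[of h P P' re n \<omega>, OF assms] by (simp add: LIMSEQ_unique)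
  then show ?thesis by (simp add: loss_def)
qed

text \<open>Fatou's lemma needs no control of plays with infinitely many fees.\<close>
lemma loss_le_of_martingale:
  assumes P: "\<And>j. is_strategy (P j)" and h: "valid re n h"
    and mart: "\<And>g. valid re n g \<Longrightarrow> \<not> terminal g \<Longrightarrow>
      (\<Sum>B\<in>Pow (active re n g). bid_set_prob re n P g B * pot i (g @ [B])) = pot i g"
  shows "loss P i h \<le> ennreal (bd i - pot i h)"
proof -
  interpret d: prob_space dev by (rule prob_space_dev)
  \<comment> \<open>The expected shortfall after \<open>k\<close> stages stays at its initial value.
    The induction splits off the first stage, so \<open>h\<close> has to vary.\<close>
  have E: "(\<integral>\<^sup>+\<omega>. ennreal (bd i - pot i (run re n P h \<omega> k)) \<partial>dev) = ennreal (bd i - pot i h)" for k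
    using h
  proof (induction k arbitrary: h)
    case 0
    then show ?case using d.emeasure_space_1 by (simp del: space_dev)
  next
    case (Suc k)
    let ?A = "active re n h"
    have fin: "finite ?A" by (rule finite_active[OF Suc.prems])
    show ?case
    proof (cases "terminal h")
      case True
      then show ?thesis using d.emeasure_space_1 by (simp add: run_terminal del: space_dev run.simps)
    next
      case False
      have meas: "(\<lambda>\<omega>. ennreal (bd i - pot i (run re n P (h @ [B]) \<omega> k))) \<in> borel_measurable dev"
        if "B \<subseteq> ?A" for B
        using that Suc.prems False by (intro measurable_pot_run finite_active) simp
      have "(\<integral>\<^sup>+\<omega>. ennreal (bd i - pot i (run re n P h \<omega> (Suc k))) \<partial>dev) =
        (\<Sum>B\<in>Pow ?A. ennreal (bid_set_prob re n P h B) *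
          (\<integral>\<^sup>+\<omega>. ennreal (bd i - pot i (run re n P (h @ [B]) \<omega> k)) \<partial>dev))"
        unfolding run_Suc_drop_row[OF False]
        by (rule nn_integral_first_stage[where P = P and
              G = "\<lambda>B \<omega>. ennreal (bd i - pot i (run re n P (h @ [B]) \<omega> k))", OF P fin meas])
      also have "\<dots> = (\<Sum>B\<in>Pow ?A. ennreal (bid_set_prob re n P h B * (bd i - pot i (h @ [B]))))"
        using Suc.prems False bid_set_prob_nonneg[of P, OF P]
        by (intro sum.cong refl) (auto simp: Suc.IH ennreal_mult pot_le_bd)
      also have "\<dots> = ennreal (\<Sum>B\<in>Pow ?A. bid_set_prob re n P h B * (bd i - pot i (h @ [B])))"
        using bid_set_prob_nonneg[of P, OF P] pot_le_bd by (intro sum_ennreal) simp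
      also have "(\<Sum>B\<in>Pow ?A. bid_set_prob re n P h B * (bd i - pot i (h @ [B]))) = bd i - pot i h"
        by (simp add: right_diff_distrib sum_subtractf mart[OF Suc.prems False]
            sum_bid_set_prob[OF fin] flip: sum_distrib_right)
      finally show ?thesis .
    qed
  qed
  have "loss P i h = (\<integral>\<^sup>+\<omega>. liminf (\<lambda>k. ennreal (bd i - pot i (run re n P h \<omega> k))) \<partial>dev)"
    unfolding loss_def
    by (intro nn_integral_cong lim_imp_Liminf[symmetric] path_loss_tendsto) simp
  also have "\<dots> \<le> liminf (\<lambda>k. \<integral>\<^sup>+\<omega>. ennreal (bd i - pot i (run re n P h \<omega> k)) \<partial>dev)"
    by (rule nn_integral_liminf[OF measurable_pot_run[OF finite_active[OF h]]])
  also have "\<dots> = ennreal (bd i - pot i h)"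
    unfolding E by (intro lim_imp_Liminf) auto
  finally show ?thesis .
qed

text \<open>A player improves on her current utility only by winning, and the winning bid itself
  costs a fee. The improvement is therefore at most that of receiving \<open>v - s - c\<close>,
  weighted by the probability of winning.\<close>

lemma pot_le_loss_plus_win_prob:
  assumes h: "valid re n h" "\<not> terminal h"
  shows "ennreal (bd i - pot i h) \<le> loss P i h +
    ennreal (exp (- \<rho> * wealth c w0 i h) * u \<rho> (v - s - c) * measure dev {\<omega>. wins re n P h \<omega> i})"
proof -
  interpret d: prob_space dev by (rule prob_space_dev)
  define K where "K = exp (- \<rho> * wealth c w0 i h) * u \<rho> (v - s - c)"
  let ?W = "{\<omega>. wins re n P h \<omega> i}"
  have fin: "finite (active re n h)" by (rule finite_active[OF h(1)])
  have K: "K \<ge> 0" using u_strict_mono[of 0 "v - s - c" \<rho>] c_less by (simp add: K_def)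
  have le: "pot i (run re n P h \<omega> k) \<le> pot i h + K * indicator ?W \<omega>" for \<omega> k
  proof -
    obtain l where l: "run re n P h \<omega> k = h @ l" using run_extends by blast
    show ?thesis
    proof (cases "{i} \<in> set l")
      case True
      then have "wins re n P h \<omega> i" using l by (auto simp: wins_def intro!: exI[of _ k])
      moreover have "1 \<le> nbids i l" using nbids_pos[OF True, of i] by simp
      then have "c * 1 \<le> c * real (nbids i l)" using c_pos by (intro mult_left_mono) auto
      then have "pot i (h @ l) \<le> u \<rho> (wealth c w0 i h + (v - s - c))"
        unfolding pot_def using True c_pos
        by (intro u_mono) (auto simp: wealth_def nbids_append algebra_simps)
      ultimately show ?thesis
        using l by (simp add: u_add K_def pot_nonterminal[OF h(2)])
    next
      case False
      then have "pot i (h @ l) \<le> pot i h"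
        unfolding pot_def using nonterminal_no_singleton[OF h(2)] c_pos
        by (intro u_mono) (auto simp: wealth_def nbids_append algebra_simps)
      moreover have "0 \<le> K * indicator ?W \<omega>" using K by simp
      ultimately show ?thesis using l by simp
    qed
  qed
  have "ennreal (bd i - pot i h) \<le>
      ennreal (bd i - pot i (run re n P h \<omega> k)) + ennreal K * indicator ?W \<omega>" for \<omega> k
  proof -
    have "ennreal (bd i - pot i h) \<le> ennreal (bd i - pot i (run re n P h \<omega> k) + K * indicator ?W \<omega>)"
      using le[of \<omega> k] by (intro ennreal_leI) (simp add: algebra_simps)
    then show ?thesis
      using K pot_le_bd[of i "run re n P h \<omega> k"]
      by (cases "wins re n P h \<omega> i") (auto simp: ennreal_plus)
  qed
  then have "ennreal (bd i - pot i h) \<le> path_loss P i h \<omega> + ennreal K * indicator ?W \<omega>" for \<omega>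
    by (intro tendsto_lowerbound[OF tendsto_add[OF path_loss_tendsto tendsto_const]]) auto
  then have "(\<integral>\<^sup>+\<omega>. ennreal (bd i - pot i h) \<partial>dev) \<le>
      (\<integral>\<^sup>+\<omega>. path_loss P i h \<omega> + ennreal K * indicator ?W \<omega> \<partial>dev)"
    by (intro nn_integral_mono)
  also have "\<dots> = loss P i h + ennreal K * emeasure dev ?W"
    using sets_wins[OF fin, of P i]
    by (subst nn_integral_add)
      (auto simp: loss_def nn_integral_cmult_indicator intro!: measurable_path_loss[OF fin] borel_measurable_times_ennreal borel_measurable_indicator)
  finally show ?thesis
    using K d.emeasure_space_1
    by (simp add: K_def d.emeasure_eq_measure ennreal_mult del: space_dev)
qed

end

section \<open>One-stage deviations\<close>

text \<open>Here \<open>A\<close> is the set of active opponents of one player; by symmetry they all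
  bid with the same probability \<open>p\<close>.\<close>

definition rest_prob :: "real \<Rightarrow> nat set \<Rightarrow> nat set \<Rightarrow> real" where
  "rest_prob p A B = (\<Prod>j\<in>A. if j \<in> B then p else 1 - p)"

lemma rest_prob_nonneg: "0 \<le> p \<Longrightarrow> p \<le> 1 \<Longrightarrow> 0 \<le> rest_prob p A B"
  unfolding rest_prob_def by (intro prod_nonneg) auto

lemma rest_prob_empty: "rest_prob p A {} = (1 - p) ^ card A"
  by (simp add: rest_prob_def)

lemma rest_prob_single:
  assumes "finite A" "j \<in> A"
  shows "rest_prob p A {j} = p * (1 - p) ^ (card A - 1)"
proof -
  have "rest_prob p A {j} = p * (\<Prod>k\<in>A - {j}. if k \<in> {j} then p else 1 - p)"
    unfolding rest_prob_def by (subst prod.remove[OF assms]) simp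
  also have "(\<Prod>k\<in>A - {j}. if k \<in> {j} then p else 1 - p) = (\<Prod>k\<in>A - {j}. 1 - p)"
    by (intro prod.cong) auto
  finally show ?thesis using assms by simp
qed

lemma sum_Pow_remove:
  fixes f :: "'a set \<Rightarrow> 'b::comm_monoid_add"
  assumes "finite A" "i \<in> A"
  shows "(\<Sum>B\<in>Pow A. f B) = (\<Sum>B\<in>Pow (A - {i}). f (insert i B)) + (\<Sum>B\<in>Pow (A - {i}). f B)"
proof -
  have A: "A = insert i (A - {i})" using assms by auto
  have "(\<Sum>B\<in>Pow A. f B) = (\<Sum>B\<in>Pow (A - {i}) \<union> insert i ` Pow (A - {i}). f B)"
    by (subst A, subst Pow_insert) simp
  also have "\<dots> = (\<Sum>B\<in>Pow (A - {i}). f B) + (\<Sum>B\<in>insert i ` Pow (A - {i}). f B)"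
    using assms by (intro sum.union_disjoint) auto
  also have "(\<Sum>B\<in>insert i ` Pow (A - {i}). f B) = (\<Sum>B\<in>Pow (A - {i}). f (insert i B))"
    by (subst sum.reindex) (auto simp: inj_on_def)
  finally show ?thesis by (simp add: add.commute)
qed

text \<open>Conditioning on the action of player \<open>i\<close>. Only her probability may differ
  from \<open>p\<close>, which covers symmetric profiles and unilateral deviations alike.\<close>

lemma sum_bid_set_prob_split:
  fixes f :: "nat set \<Rightarrow> real"
  assumes fin: "finite (active re n h)" and i: "i \<in> active re n h"
    and p: "\<And>j. j \<noteq> i \<Longrightarrow> P j h = p"
  shows "(\<Sum>B\<in>Pow (active re n h). bid_set_prob re n P h B * f B) =
    P i h * (\<Sum>B\<in>Pow (active re n h - {i}). rest_prob p (active re n h - {i}) B * f (insert i B)) +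
    (1 - P i h) * (\<Sum>B\<in>Pow (active re n h - {i}). rest_prob p (active re n h - {i}) B * f B)"
proof -
  let ?A = "active re n h"
  have rest: "(\<Prod>j\<in>?A - {i}. if j \<in> C then P j h else 1 - P j h) = rest_prob p (?A - {i}) B"
    if "C - {i} = B - {i}" for B C
    unfolding rest_prob_def using that p by (intro prod.cong) auto
  have 1: "bid_set_prob re n P h (insert i B) = P i h * rest_prob p (?A - {i}) B" for B
    unfolding bid_set_prob_def by (subst prod.remove[OF fin i], subst rest) auto
  have 2: "bid_set_prob re n P h B = (1 - P i h) * rest_prob p (?A - {i}) B" if "i \<notin> B" for B
    unfolding bid_set_prob_def using that by (subst prod.remove[OF fin i], subst rest) auto
  show ?thesis
    unfolding sum_Pow_remove[OF fin i] sum_distrib_left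
    by (intro arg_cong2[where f = "(+)"] sum.cong refl) (auto simp: 1 subset_Diff_insert 2)
qed

lemma sum_rest_prob: "finite A \<Longrightarrow> (\<Sum>B\<in>Pow A. rest_prob p A B) = 1"
  unfolding rest_prob_def by (rule sum_Pow_prod_if_complement)

text \<open>In the applications \<open>C\<close> is empty, so that a bidding player wins alone, or
  consists of one opponent, who then wins against a player not bidding.\<close>

lemma sum_rest_prob_if:
  assumes "finite A" "C \<subseteq> A"
  shows "(\<Sum>B\<in>Pow A. rest_prob p A B * (if B = C then a else b)) = b + rest_prob p A C * (a - b)"
proof -
  have "(\<Sum>B\<in>Pow A. rest_prob p A B * (if B = C then a else b)) =
      (\<Sum>B\<in>Pow A. rest_prob p A B * b) + (\<Sum>B\<in>Pow A. if B = C then rest_prob p A B * (a - b) else 0)"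
    unfolding sum.distrib[symmetric] by (intro sum.cong) (auto simp: algebra_simps)
  then show ?thesis
    using assms by (simp add: sum_rest_prob flip: sum_distrib_right)
qed

context pay_to_bid
begin

section \<open>Values and one-shot deviations\<close>

text \<open>Expected utility as a real number. \<open>enn2real\<close> sends \<open>\<top>\<close>
  to 0, so it has this meaning only where the loss is finite.\<close>

definition val :: "(nat \<Rightarrow> nat set list \<Rightarrow> real) \<Rightarrow> nat \<Rightarrow> nat set list \<Rightarrow> real" where
  "val P i h = bd i - enn2real (loss P i h)"

lemma val_step:
  assumes P: "\<And>j. is_strategy (P j)" and h: "valid re n h" "\<not> terminal h"
    and fin: "\<And>B. B \<subseteq> active re n h \<Longrightarrow> loss P i (h @ [B]) \<noteq> \<top>"
  shows "loss P i h \<noteq> \<top>"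
    and "val P i h = (\<Sum>B\<in>Pow (active re n h). bid_set_prob re n P h B * val P i (h @ [B]))"
proof -
  let ?A = "active re n h"
  have A: "finite ?A" by (rule finite_active[OF h(1)])
  note nn = bid_set_prob_nonneg[of P, OF P]
  have "loss P i h = (\<Sum>B\<in>Pow ?A. ennreal (bid_set_prob re n P h B * enn2real (loss P i (h @ [B]))))"
    unfolding loss_step[of P, OF P h] using nn fin
    by (intro sum.cong refl) (auto simp: ennreal_mult ennreal_enn2real_if)
  also have "\<dots> = ennreal (\<Sum>B\<in>Pow ?A. bid_set_prob re n P h B * enn2real (loss P i (h @ [B])))"
    using nn by (intro sum_ennreal) auto
  finally have eq: "loss P i h = ennreal (\<Sum>B\<in>Pow ?A. bid_set_prob re n P h B * enn2real (loss P i (h @ [B])))" .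
  then show "loss P i h \<noteq> \<top>" by simp
  have "enn2real (loss P i h) = (\<Sum>B\<in>Pow ?A. bid_set_prob re n P h B * enn2real (loss P i (h @ [B])))"
    unfolding eq using nn by (intro enn2real_ennreal sum_nonneg) auto
  then show "val P i h = (\<Sum>B\<in>Pow ?A. bid_set_prob re n P h B * val P i (h @ [B]))"
    by (simp add: val_def right_diff_distrib sum_subtractf sum_bid_set_prob[OF A] flip: sum_distrib_right)
qed

lemma val_eq_pot: "loss P i h = ennreal (bd i - pot i h) \<Longrightarrow> val P i h = pot i h"
  using pot_le_bd[of i h] by (simp add: val_def)

lemma val_terminal: "terminal h \<Longrightarrow> val P i h = pot i h"
  by (intro val_eq_pot loss_terminal)

lemma val_inactive: "valid re n h \<Longrightarrow> i < n \<Longrightarrow> i \<notin> active re n h \<Longrightarrow> val P i h = pot i h"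
  by (intro val_eq_pot loss_inactive)

lemma pot_le_val:
  assumes "loss P i h \<le> ennreal (bd i - pot i h)"
  shows "loss P i h \<noteq> \<top>" "pot i h \<le> val P i h"
proof -
  show "loss P i h \<noteq> \<top>" using assms by (auto simp: top_unique)
  have "enn2real (loss P i h) \<le> bd i - pot i h"
    using assms pot_le_bd[of i h] by (simp add: enn2real_leI)
  then show "pot i h \<le> val P i h" by (simp add: val_def)
qed

lemma loss_eq_of_val:
  assumes "loss P i h \<noteq> \<top>" "val P i h = pot i h"
  shows "loss P i h = ennreal (bd i - pot i h)"
  using assms by (cases "loss P i h") (auto simp: val_def)

lemma sum_pot_not_bidding:
  assumes g: "\<not> terminal g" and A: "finite A" "i \<notin> A"
  shows "(\<Sum>B\<in>Pow A. rest_prob p A B * pot i (g @ [B])) = pot i g"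
proof -
  have "(\<Sum>B\<in>Pow A. rest_prob p A B * pot i (g @ [B])) = (\<Sum>B\<in>Pow A. rest_prob p A B * pot i g)"
    using A by (intro sum.cong refl) (auto simp: pot_snoc[OF g])
  then show ?thesis by (simp add: sum_rest_prob[OF A(1)] flip: sum_distrib_right)
qed

lemma sum_pot_inactive:
  assumes g: "valid re n g" "\<not> terminal g" and i: "i \<notin> active re n g"
  shows "(\<Sum>B\<in>Pow (active re n g). bid_set_prob re n P g B * pot i (g @ [B])) = pot i g"
proof -
  have "(\<Sum>B\<in>Pow (active re n g). bid_set_prob re n P g B * pot i (g @ [B])) =
      (\<Sum>B\<in>Pow (active re n g). bid_set_prob re n P g B * pot i g)"
    using i by (intro sum.cong refl) (auto simp: pot_snoc[OF g(2)])
  then show ?thesis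
    by (simp add: sum_bid_set_prob[OF finite_active[OF g(1)]] flip: sum_distrib_right)
qed

text \<open>Deviate to never bidding: the potential then stays unchanged in every stage, and the
  equilibrium can do no worse. This also makes all equilibrium losses finite.\<close>

lemma SSPE_loss_le:
  assumes sspe: "SSPE re n v c s \<rho> w0 \<sigma>" and h: "valid re n h" and i: "i < n"
  shows "loss (\<lambda>_. \<sigma>) i h \<le> ennreal (bd i - pot i h)"
proof (cases "terminal h")
  case False
  let ?P = "(\<lambda>_. \<sigma>)(i := (\<lambda>_. 0))"
  have \<sigma>: "is_strategy \<sigma>" using sspe by (simp add: SSPE_def)
  have 0: "is_strategy (\<lambda>_. 0)" by (simp add: is_strategy_def)
  have "loss (\<lambda>_. \<sigma>) i h \<le> loss ?P i h"
    using sspe h False i 0 unfolding SSPE_def EU_le_iff by blast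
  also have "\<dots> \<le> ennreal (bd i - pot i h)"
  proof (rule loss_le_of_martingale[OF _ h])
    show "is_strategy (?P j)" for j using \<sigma> 0 by simp
    fix g assume g: "valid re n g" "\<not> terminal g"
    show "(\<Sum>B\<in>Pow (active re n g). bid_set_prob re n ?P g B * pot i (g @ [B])) = pot i g"
    proof (cases "i \<in> active re n g")
      case True
      then show ?thesis
        using finite_active[OF g(1)]
        by (subst sum_bid_set_prob_split[where p = "\<sigma> g" and i = i])
          (auto simp: sum_pot_not_bidding[OF g(2)])
    qed (rule sum_pot_inactive[OF g])
  qed
  finally show ?thesis .
qed (simp add: loss_terminal)

text \<open>Let player \<open>i\<close> bid with probability \<open>x\<close> at \<open>h\<close>
  and follow \<open>\<sigma>\<close> elsewhere. Her value is affine in \<open>x\<close>, equal to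
  \<open>bid\<close> at 1 and to \<open>nobid\<close> at 0, and maximal at
  \<open>x = \<sigma> h\<close>.\<close>

lemma SSPE_one_shot:
  assumes sspe: "SSPE re n v c s \<rho> w0 \<sigma>" and h: "valid re n h" "\<not> terminal h"
    and i: "i \<in> active re n h"
  defines "A' \<equiv> active re n h - {i}"
  defines "bid \<equiv> \<Sum>B\<in>Pow A'. rest_prob (\<sigma> h) A' B * val (\<lambda>_. \<sigma>) i (h @ [insert i B])"
  defines "nobid \<equiv> \<Sum>B\<in>Pow A'. rest_prob (\<sigma> h) A' B * val (\<lambda>_. \<sigma>) i (h @ [B])"
  shows "bid \<le> val (\<lambda>_. \<sigma>) i h" "nobid \<le> val (\<lambda>_. \<sigma>) i h"
    "\<sigma> h > 0 \<Longrightarrow> val (\<lambda>_. \<sigma>) i h = bid" "\<sigma> h < 1 \<Longrightarrow> val (\<lambda>_. \<sigma>) i h = nobid"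
proof -
  let ?A = "active re n h"
  have \<sigma>: "is_strategy \<sigma>" using sspe by (simp add: SSPE_def)
  have fin: "finite ?A" by (rule finite_active[OF h(1)])
  have i_n: "i < n" using i active_subset[OF h(1)] by auto
  have ntop: "loss (\<lambda>_. \<sigma>) i g \<noteq> \<top>" if "valid re n g" for g
    using pot_le_val(1)[OF SSPE_loss_le[OF sspe that i_n]] .
  have le: "x * bid + (1 - x) * nobid \<le> val (\<lambda>_. \<sigma>) i h"
    and eq: "x = \<sigma> h \<Longrightarrow> val (\<lambda>_. \<sigma>) i h = x * bid + (1 - x) * nobid" if x: "0 \<le> x" "x \<le> 1" for x
  proof -
    let ?\<tau> = "\<sigma>(h := x)"
    let ?P = "(\<lambda>_. \<sigma>)(i := ?\<tau>)"
    have \<tau>: "is_strategy ?\<tau>" using \<sigma> x by (simp add: is_strategy_def)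
    have P: "is_strategy (?P j)" for j using \<tau> \<sigma> by simp
    have cont: "loss ?P i (h @ [B]) = loss (\<lambda>_. \<sigma>) i (h @ [B])" for B
      by (rule loss_cong) auto
    have fin': "loss ?P i (h @ [B]) \<noteq> \<top>" if "B \<subseteq> ?A" for B
      unfolding cont using that h by (intro ntop) simp
    have "val ?P i h = (\<Sum>B\<in>Pow ?A. bid_set_prob re n ?P h B * val (\<lambda>_. \<sigma>) i (h @ [B]))"
      using val_step(2)[of ?P, OF P h fin'] by (simp add: val_def cont)
    also have "\<dots> = x * bid + (1 - x) * nobid"
      unfolding bid_def nobid_def A'_def
      by (subst sum_bid_set_prob_split[where p = "\<sigma> h" and i = i]) (use fin i in auto)
    finally have v: "val ?P i h = x * bid + (1 - x) * nobid" .
    have "loss (\<lambda>_. \<sigma>) i h \<le> loss ?P i h"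
      using sspe h i_n \<tau> unfolding SSPE_def EU_le_iff by blast
    moreover have "loss ?P i h \<noteq> \<top>" by (rule val_step(1)[of ?P, OF P h fin'])
    ultimately have "val ?P i h \<le> val (\<lambda>_. \<sigma>) i h"
      by (simp add: val_def enn2real_mono top.not_eq_extremum)
    with v show "x * bid + (1 - x) * nobid \<le> val (\<lambda>_. \<sigma>) i h" by simp
    show "val (\<lambda>_. \<sigma>) i h = x * bid + (1 - x) * nobid" if "x = \<sigma> h"
    proof -
      have "?P = (\<lambda>_. \<sigma>)" using that by auto
      with v show ?thesis by simp
    qed
  qed
  show 1: "bid \<le> val (\<lambda>_. \<sigma>) i h" using le[of 1] by simp
  show 2: "nobid \<le> val (\<lambda>_. \<sigma>) i h" using le[of 0] by simp
  have p: "0 \<le> \<sigma> h" "\<sigma> h \<le> 1" using \<sigma> by (auto simp: is_strategy_def)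
  have e: "val (\<lambda>_. \<sigma>) i h = \<sigma> h * bid + (1 - \<sigma> h) * nobid" using eq[OF p] by simp
  \<comment> \<open>Both summands are nonnegative, so both vanish: an action used with positive
    probability is optimal.\<close>
  have e': "\<sigma> h * (val (\<lambda>_. \<sigma>) i h - bid) + (1 - \<sigma> h) * (val (\<lambda>_. \<sigma>) i h - nobid) = 0"
    using e by (simp add: algebra_simps)
  have "0 \<le> \<sigma> h * (val (\<lambda>_. \<sigma>) i h - bid)" "0 \<le> (1 - \<sigma> h) * (val (\<lambda>_. \<sigma>) i h - nobid)"
    using 1 2 p by auto
  with e' have z: "\<sigma> h * (val (\<lambda>_. \<sigma>) i h - bid) = 0" "(1 - \<sigma> h) * (val (\<lambda>_. \<sigma>) i h - nobid) = 0"
    by linarith+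
  show "\<sigma> h > 0 \<Longrightarrow> val (\<lambda>_. \<sigma>) i h = bid" "\<sigma> h < 1 \<Longrightarrow> val (\<lambda>_. \<sigma>) i h = nobid"
    using z by auto
qed

text \<open>The factor is chosen so that wealth does not occur in the recursion \<open>SSPE_gain\<close>.\<close>
definition gain :: "(nat set list \<Rightarrow> real) \<Rightarrow> nat \<Rightarrow> nat set list \<Rightarrow> real" where
  "gain \<sigma> i h = (val (\<lambda>_. \<sigma>) i h - pot i h) * exp (\<rho> * wealth c w0 i h)"

lemma val_gain: "val (\<lambda>_. \<sigma>) i h = pot i h + exp (- \<rho> * wealth c w0 i h) * gain \<sigma> i h"
  by (simp add: gain_def exp_minus field_simps)

lemma u_minus_c: "u \<rho> (- c) = - exp (\<rho> * c) * u \<rho> c"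
  using u_add[of \<rho> "- c" c] by simp

lemma u_prize_minus_c: "u \<rho> (v - s - c) = exp (\<rho> * c) * (u \<rho> (v - s) - u \<rho> c)"
  using u_add[of \<rho> "- c" "v - s"] by (simp add: u_minus_c algebra_simps)

lemma gain_nobid:
  assumes "\<not> terminal h" "i \<notin> B"
  shows "val (\<lambda>_. \<sigma>) i (h @ [B]) = pot i h + exp (- \<rho> * wealth c w0 i h) * gain \<sigma> i (h @ [B])"
  unfolding val_gain using assms by (auto simp: pot_snoc wealth_snoc)

text \<open>If an opponent bids as well, the fee is lost and the gain that follows is rescaled by
  \<open>exp (\<rho> * c)\<close>, since wealth has fallen by \<open>c\<close>. For
  \<open>\<rho> \<le> 0\<close> this factor acts as a discount.\<close>

lemma gain_bid:
  assumes h: "\<not> terminal h" and B: "i \<notin> B"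
  shows "val (\<lambda>_. \<sigma>) i (h @ [insert i B]) = pot i h + exp (- \<rho> * wealth c w0 i h) *
    (if B = {} then u \<rho> (v - s - c) else exp (\<rho> * c) * (gain \<sigma> i (h @ [insert i B]) - u \<rho> c))"
proof (cases "B = {}")
  case True
  then show ?thesis
    using u_add[of \<rho> "wealth c w0 i h" "v - s - c"]
    by (simp add: val_terminal pot_snoc[OF h] pot_nonterminal[OF h] algebra_simps)
next
  case False
  then have ne: "insert i B \<noteq> {i}" using B by auto
  have e: "exp (- \<rho> * (wealth c w0 i h - c)) = exp (- \<rho> * wealth c w0 i h) * exp (\<rho> * c)"
    by (simp add: exp_add[symmetric] algebra_simps)
  show ?thesis
    unfolding val_gain using False ne u_add[of \<rho> "wealth c w0 i h" "- c"] e
    by (simp add: pot_snoc[OF h] pot_nonterminal[OF h] wealth_snoc u_minus_c algebra_simps)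
qed

section \<open>The equilibrium conditions in terms of gains\<close>

text \<open>\<open>SSPE_one_shot\<close> with current utility subtracted and the positive factor
  \<open>E\<close> cancelled.\<close>

lemma SSPE_gain:
  assumes sspe: "SSPE re n v c s \<rho> w0 \<sigma>" and h: "valid re n h" "\<not> terminal h"
    and i: "i \<in> active re n h"
  defines "A' \<equiv> active re n h - {i}"
  defines "bid \<equiv> \<Sum>B\<in>Pow A'. rest_prob (\<sigma> h) A' B *
    (if B = {} then u \<rho> (v - s - c) else exp (\<rho> * c) * (gain \<sigma> i (h @ [insert i B]) - u \<rho> c))"
  defines "nobid \<equiv> \<Sum>B\<in>Pow A'. rest_prob (\<sigma> h) A' B * gain \<sigma> i (h @ [B])"
  shows "bid \<le> gain \<sigma> i h" "nobid \<le> gain \<sigma> i h"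
    "\<sigma> h > 0 \<Longrightarrow> gain \<sigma> i h = bid" "\<sigma> h < 1 \<Longrightarrow> gain \<sigma> i h = nobid"
proof -
  define E where "E = exp (- \<rho> * wealth c w0 i h)"
  have A': "finite A'" using finite_active[OF h(1)] by (simp add: A'_def)
  have E: "E > 0" by (simp add: E_def)
  have 1: "(\<Sum>B\<in>Pow A'. rest_prob (\<sigma> h) A' B * val (\<lambda>_. \<sigma>) i (h @ [insert i B])) = pot i h + E * bid"
  proof -
    have "(\<Sum>B\<in>Pow A'. rest_prob (\<sigma> h) A' B * val (\<lambda>_. \<sigma>) i (h @ [insert i B])) =
        (\<Sum>B\<in>Pow A'. rest_prob (\<sigma> h) A' B * (pot i h + E * (if B = {} then u \<rho> (v - s - c)
          else exp (\<rho> * c) * (gain \<sigma> i (h @ [insert i B]) - u \<rho> c))))"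
      unfolding E_def by (intro sum.cong refl, subst gain_bid[OF h(2)]) (auto simp: A'_def)
    also have "\<dots> = pot i h + E * bid"
      unfolding bid_def
      by (simp add: distrib_left sum.distrib sum_distrib_left sum_rest_prob[OF A'] mult.left_commute
          flip: sum_distrib_right cong: if_cong)
    finally show ?thesis .
  qed
  have 2: "(\<Sum>B\<in>Pow A'. rest_prob (\<sigma> h) A' B * val (\<lambda>_. \<sigma>) i (h @ [B])) = pot i h + E * nobid"
  proof -
    have "(\<Sum>B\<in>Pow A'. rest_prob (\<sigma> h) A' B * val (\<lambda>_. \<sigma>) i (h @ [B])) =
        (\<Sum>B\<in>Pow A'. rest_prob (\<sigma> h) A' B * (pot i h + E * gain \<sigma> i (h @ [B])))"
      unfolding E_def by (intro sum.cong refl, subst gain_nobid[OF h(2)]) (auto simp: A'_def)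
    also have "\<dots> = pot i h + E * nobid"
      unfolding nobid_def
      by (simp add: distrib_left sum.distrib sum_distrib_left sum_rest_prob[OF A'] mult.left_commute
          flip: sum_distrib_right)
    finally show ?thesis .
  qed
  have v: "val (\<lambda>_. \<sigma>) i h = pot i h + E * gain \<sigma> i h" unfolding E_def by (rule val_gain)
  note os = SSPE_one_shot[OF sspe h i, folded A'_def, unfolded 1 2 v]
  show "bid \<le> gain \<sigma> i h" "nobid \<le> gain \<sigma> i h"
    "\<sigma> h > 0 \<Longrightarrow> gain \<sigma> i h = bid" "\<sigma> h < 1 \<Longrightarrow> gain \<sigma> i h = nobid"
    using os E by auto
qed

lemma SSPE_gain_nonneg:
  assumes "SSPE re n v c s \<rho> w0 \<sigma>" "valid re n h" "i < n"
  shows "0 \<le> gain \<sigma> i h"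
  using pot_le_val(2)[OF SSPE_loss_le[OF assms]] by (simp add: gain_def)

lemma gain_terminal: "terminal h \<Longrightarrow> gain \<sigma> i h = 0"
  by (simp add: gain_def val_terminal)

lemma gain_inactive: "valid re n h \<Longrightarrow> i < n \<Longrightarrow> i \<notin> active re n h \<Longrightarrow> gain \<sigma> i h = 0"
  by (simp add: gain_def val_inactive)

lemma SSPE_gain_le_win_prob:
  assumes sspe: "SSPE re n v c s \<rho> w0 \<sigma>" and h: "valid re n h" "\<not> terminal h" and i: "i < n"
  shows "gain \<sigma> i h \<le> u \<rho> (v - s - c) * measure dev {\<omega>. wins re n (\<lambda>_. \<sigma>) h \<omega> i}"
proof -
  define E where "E = exp (- \<rho> * wealth c w0 i h)"
  let ?K = "u \<rho> (v - s - c) * measure dev {\<omega>. wins re n (\<lambda>_. \<sigma>) h \<omega> i}"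
  have E: "E > 0" by (simp add: E_def)
  have "u \<rho> (v - s - c) > 0" using u_strict_mono[of 0 "v - s - c" \<rho>] c_less by simp
  then have K: "0 \<le> E * ?K" using E by simp
  have fin: "loss (\<lambda>_. \<sigma>) i h \<noteq> \<top>"
    by (rule pot_le_val(1)[OF SSPE_loss_le[OF sspe h(1) i]])
  have "ennreal (bd i - pot i h) \<le> loss (\<lambda>_. \<sigma>) i h + ennreal (E * ?K)"
    using pot_le_loss_plus_win_prob[OF h, of i "\<lambda>_. \<sigma>"] by (simp add: E_def mult.assoc)
  also have "\<dots> = ennreal (enn2real (loss (\<lambda>_. \<sigma>) i h) + E * ?K)"
    using fin K by (simp add: ennreal_enn2real_if)
  finally have "bd i - pot i h \<le> enn2real (loss (\<lambda>_. \<sigma>) i h) + E * ?K"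
    using K by (subst (asm) ennreal_le_iff) auto
  then have "E * gain \<sigma> i h \<le> E * ?K"
    using val_gain[of \<sigma> i h, folded E_def] unfolding val_def by linarith
  then show ?thesis using E by simp
qed

end

section \<open>Equilibrium\<close>

text \<open>Bernoulli's inequality, with slack in the exponent so that the total number of players
  can stand in for the number of opponents.\<close>

lemma power_ge_one_minus_mult:
  fixes p :: real
  assumes "0 \<le> p" "p \<le> 1" "k \<le> m"
  shows "1 - real m * p \<le> (1 - p) ^ k"
proof -
  have "real k * p \<le> real m * p" using assms by (intro mult_right_mono) auto
  then show ?thesis using Bernoulli_inequality[of "- p" k] assms by simp
qed

context pay_to_bid
begin

section \<open>The closed form of the bidding probability\<close>

lemma u_c_pos: "0 < u \<rho> c"
  using u_strict_mono[of 0 c \<rho>] c_pos by simp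

lemma u_c_less: "u \<rho> c < u \<rho> (v - s)"
  using u_strict_mono[of c "v - s" \<rho>] c_less by simp

lemma u_prize_minus_c_pos: "0 < u \<rho> (v - s - c)"
  using u_strict_mono[of 0 "v - s - c" \<rho>] c_less by simp

text \<open>The power is the probability that none of \<open>m - 1\<close> opponents bids. Its value
  makes the chance of the prize, worth \<open>u \<rho> (v - s)\<close>, just compensate the fee,
  worth \<open>u \<rho> c\<close>.\<close>

lemma bid_prob_bounds:
  assumes "m \<ge> 2"
  shows "0 < bid_prob \<rho> v c s m" "bid_prob \<rho> v c s m < 1"
    and bid_prob_power: "(1 - bid_prob \<rho> v c s m) ^ (m - 1) = u \<rho> c / u \<rho> (v - s)"
proof -
  define r where "r = u \<rho> c / u \<rho> (v - s)"
  have r: "0 < r" "r < 1" using u_c_pos u_c_less by (auto simp: r_def)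
  have b: "bid_prob \<rho> v c s m = 1 - r powr (1 / (real m - 1))" by (simp add: bid_prob_def r_def)
  show 1: "bid_prob \<rho> v c s m < 1" using r by (simp add: b)
  have "(1 - bid_prob \<rho> v c s m) ^ (m - 1) = (r powr (1 / (real m - 1))) powr real (m - 1)"
    using r by (simp add: b powr_realpow)
  also have "\<dots> = r" using r assms by (simp add: powr_powr)
  finally show 2: "(1 - bid_prob \<rho> v c s m) ^ (m - 1) = u \<rho> c / u \<rho> (v - s)" by (simp add: r_def)
  show "0 < bid_prob \<rho> v c s m"
  proof (rule ccontr)
    assume "\<not> 0 < bid_prob \<rho> v c s m"
    then have "1 \<le> (1 - bid_prob \<rho> v c s m) ^ (m - 1)" by (intro one_le_power) auto
    with 2 r show False by (simp add: r_def)
  qed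
qed

lemma eq_bid_probI:
  assumes "m \<ge> 2" "p \<le> 1" "(1 - p) ^ (m - 1) = u \<rho> c / u \<rho> (v - s)"
  shows "p = bid_prob \<rho> v c s m"
proof -
  have "1 - p = 1 - bid_prob \<rho> v c s m"
  proof (rule power_eq_imp_eq_base)
    show "(1 - p) ^ (m - 1) = (1 - bid_prob \<rho> v c s m) ^ (m - 1)"
      unfolding assms(3) bid_prob_power[OF assms(1)] ..
  qed (use assms bid_prob_bounds(2)[OF assms(1)] in simp_all)
  then show ?thesis by simp
qed

lemma card_active_minus:
  assumes "valid re n h" "\<not> terminal h" "i \<in> active re n h"
  shows "card (active re n h - {i}) = card (active re n h) - 1"
    and "1 \<le> card (active re n h - {i})" "card (active re n h - {i}) \<le> n"
  using assms card_active_ge2[OF n_ge_2 assms(1,2)] card_active_le[OF assms(1)]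
    finite_active[OF assms(1)] by auto

lemma ex_opponent:
  assumes "valid re n h" "\<not> terminal h" "i \<in> active re n h"
  obtains j where "j \<in> active re n h - {i}"
  using card_active_minus(2)[OF assms] that by (cases "active re n h - {i} = {}") auto

section \<open>Necessity: equilibrium gains vanish\<close>

text \<open>For an active player with gain at most \<open>W / 2\<close>, a bid yields at least
  \<open>W\<close> if nobody else bids and at least \<open>- d\<close> otherwise, as later gains are
  nonnegative. If opponents bid too rarely, this exceeds \<open>W / 2\<close>.\<close>

lemma SSPE_bid_prob_lower_bound:
  assumes sspe: "SSPE re n v c s \<rho> w0 \<sigma>" and h: "valid re n h" "\<not> terminal h"
  shows "u \<rho> (v - s - c) / 2 \<le> real n * \<sigma> h * (u \<rho> (v - s - c) + exp (\<rho> * c) * u \<rho> c)"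
proof -
  define W where "W = u \<rho> (v - s - c)"
  define d where "d = exp (\<rho> * c) * u \<rho> c"
  have W: "W > 0" using u_prize_minus_c_pos by (simp add: W_def)
  have d: "d > 0" using u_c_pos by (simp add: d_def)
  have p: "0 \<le> \<sigma> h" "\<sigma> h \<le> 1" using sspe by (auto simp: SSPE_def is_strategy_def)
  have sub: "active re n h \<subseteq> {..<n}" by (rule active_subset[OF h(1)])
  have fin: "finite (active re n h)" by (rule finite_active[OF h(1)])
  have "card (active re n h) \<ge> 2" by (rule card_active_ge2[OF n_ge_2 h])
  then obtain a where a: "a \<in> active re n h" by fastforce
  obtain b where b: "b \<in> active re n h - {a}" using ex_opponent[OF h a] .
  let ?q = "\<lambda>i. measure dev {\<omega>. wins re n (\<lambda>_. \<sigma>) h \<omega> i}"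
  have "gain \<sigma> a h + gain \<sigma> b h \<le> W * ?q a + W * ?q b"
    unfolding W_def using a b sub by (intro add_mono SSPE_gain_le_win_prob[OF sspe h]) auto
  also have "\<dots> = W * (\<Sum>i\<in>{a, b}. ?q i)" using b by (auto simp: distrib_left)
  also have "\<dots> \<le> W * 1"
    using W by (intro mult_left_mono sum_prob_wins_le_1[OF fin h(2)]) auto
  finally have "gain \<sigma> a h \<le> W / 2 \<or> gain \<sigma> b h \<le> W / 2" by linarith
  then obtain i where i: "i \<in> active re n h" "gain \<sigma> i h \<le> W / 2" using a b by auto
  let ?A' = "active re n h - {i}"
  have i_n: "i < n" using i sub by auto
  have "(\<Sum>B\<in>Pow ?A'. rest_prob (\<sigma> h) ?A' B * (if B = {} then W else - d)) \<le> gain \<sigma> i h"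
  proof (rule order_trans[OF _ SSPE_gain(1)[OF sspe h i(1)]], intro sum_mono mult_left_mono)
    fix B assume B: "B \<in> Pow ?A'"
    then have "0 \<le> gain \<sigma> i (h @ [insert i B])"
      using h i by (intro SSPE_gain_nonneg[OF sspe _ i_n]) auto
    then have "exp (\<rho> * c) * (0 - u \<rho> c) \<le> exp (\<rho> * c) * (gain \<sigma> i (h @ [insert i B]) - u \<rho> c)"
      by (intro mult_left_mono) auto
    then show "(if B = {} then W else - d) \<le> (if B = {} then u \<rho> (v - s - c)
        else exp (\<rho> * c) * (gain \<sigma> i (h @ [insert i B]) - u \<rho> c))"
      by (simp add: W_def d_def)
  qed (rule rest_prob_nonneg[OF p])
  then have "- d + (1 - \<sigma> h) ^ card ?A' * (W + d) \<le> W / 2"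
    using fin i(2) by (subst (asm) sum_rest_prob_if) (auto simp: rest_prob_empty)
  moreover have "(1 - real n * \<sigma> h) * (W + d) \<le> (1 - \<sigma> h) ^ card ?A' * (W + d)"
    using W d p card_active_minus(3)[OF h i(1)]
    by (intro mult_right_mono power_ge_one_minus_mult) auto
  ultimately have "W / 2 \<le> real n * \<sigma> h * (W + d)"
    by (simp add: algebra_simps)
  then show ?thesis by (simp add: W_def d_def)
qed

text \<open>The factor must not depend on \<open>M\<close>, \<open>h\<close> or \<open>i\<close>, as
  the bound is iterated. The proof separates two cases by the probability \<open>y\<close> that no
  opponent bids: if it is small, the recursion for bidding applies, otherwise the one for not
  bidding.\<close>

lemma SSPE_gain_contraction:
  assumes sspe: "SSPE re n v c s \<rho> w0 \<sigma>"
  shows "\<exists>\<theta>. 0 \<le> \<theta> \<and> \<theta> < 1 \<and> (\<forall>M h i. 0 \<le> M \<and> M \<le> u \<rho> (v - s - c) \<and>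
    (\<forall>g j. valid re n g \<and> j < n \<longrightarrow> gain \<sigma> j g \<le> M) \<and> valid re n h \<and> i < n \<longrightarrow>
    gain \<sigma> i h \<le> \<theta> * M)"
proof -
  define W where "W = u \<rho> (v - s - c)"
  define G where "G = u \<rho> (v - s)"
  define \<delta> where "\<delta> = exp (\<rho> * c)"
  define d where "d = \<delta> * u \<rho> c"
  have W: "W > 0" using u_prize_minus_c_pos by (simp add: W_def)
  have d: "d > 0" using u_c_pos by (simp add: d_def \<delta>_def)
  have G: "G > 0" using u_c_pos u_c_less by (simp add: G_def)
  have \<delta>: "0 < \<delta>" "\<delta> \<le> 1" using rho c_pos by (auto simp: \<delta>_def mult_nonpos_nonneg)
  have W_eq: "W = \<delta> * G - d"
    unfolding W_def G_def \<delta>_def d_def u_prize_minus_c by (simp add: algebra_simps)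
  \<comment> \<open>\<open>SSPE_bid_prob_lower_bound\<close> solved for the bidding
    probability.\<close>
  define p0 where "p0 = W / (2 * real n * (W + d))"
  \<comment> \<open>The threshold for \<open>y\<close>, below which the chance of the prize recovers
    at most half of the fee.\<close>
  define \<epsilon> where "\<epsilon> = u \<rho> c / (2 * G)"
  have p0: "p0 > 0" using W d n_ge_2 by (simp add: p0_def)
  have \<epsilon>: "\<epsilon> > 0" using u_c_pos G by (simp add: \<epsilon>_def)
  \<comment> \<open>The second and third entries come from the two cases; the first keeps the factor
    nonnegative.\<close>
  define \<theta> where "\<theta> = max (1/2) (max (1 - d / (2 * W)) (1 - p0 * \<epsilon>))"
  have "gain \<sigma> i h \<le> \<theta> * M"
    if M: "0 \<le> M" "M \<le> W" and le: "\<forall>g j. valid re n g \<and> j < n \<longrightarrow> gain \<sigma> j g \<le> M"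
      and h: "valid re n h" and i: "i < n" for M h i
  proof (cases "terminal h \<or> i \<notin> active re n h")
    case True
    then have "gain \<sigma> i h = 0" using h i by (auto simp: gain_terminal gain_inactive)
    then show ?thesis using M by (simp add: \<theta>_def)
  next
    case False
    then have nt: "\<not> terminal h" and ia: "i \<in> active re n h" by auto
    let ?A' = "active re n h - {i}"
    let ?p = "\<sigma> h"
    define y where "y = (1 - ?p) ^ card ?A'"
    have fin: "finite ?A'" using finite_active[OF h] by simp
    have p: "0 \<le> ?p" "?p \<le> 1" using sspe by (auto simp: SSPE_def is_strategy_def)
    have "W / 2 \<le> real n * ?p * (W + d)"
      unfolding W_def d_def \<delta>_def by (rule SSPE_bid_prob_lower_bound[OF sspe h nt])
    moreover have "0 < 2 * real n * (W + d)" using W d n_ge_2 by simp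
    ultimately have p_ge: "p0 \<le> ?p"
      unfolding p0_def by (subst pos_divide_le_eq) (simp_all add: mult_ac)
    show ?thesis
    proof (cases "y * G \<le> u \<rho> c / 2")
      case True
      have "gain \<sigma> i h \<le> (\<Sum>B\<in>Pow ?A'. rest_prob ?p ?A' B * (if B = {} then W else \<delta> * M - d))"
      proof (subst SSPE_gain(3)[OF sspe h nt ia], use p_ge p0 in simp, intro sum_mono mult_left_mono)
        fix B assume B: "B \<in> Pow ?A'"
        then have "valid re n (h @ [insert i B])" using h nt ia by auto
        then have "gain \<sigma> i (h @ [insert i B]) \<le> M" using i le by blast
        then have "\<delta> * (gain \<sigma> i (h @ [insert i B]) - u \<rho> c) \<le> \<delta> * (M - u \<rho> c)"
          using \<delta> by (intro mult_left_mono) auto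
        then show "(if B = {} then u \<rho> (v - s - c) else exp (\<rho> * c) * (gain \<sigma> i (h @ [insert i B]) - u \<rho> c))
            \<le> (if B = {} then W else \<delta> * M - d)"
          by (simp add: W_def d_def \<delta>_def algebra_simps)
      qed (rule rest_prob_nonneg[OF p])
      also have "\<dots> = \<delta> * M - d + y * (W - (\<delta> * M - d))"
        using fin by (simp add: sum_rest_prob_if rest_prob_empty y_def)
      also have "\<dots> = \<delta> * M * (1 - y) - d + \<delta> * (y * G)"
        by (simp add: W_eq algebra_simps)
      also have "\<dots> \<le> M - d + \<delta> * (u \<rho> c / 2)"
      proof -
        have "0 \<le> y" "y \<le> 1" using p by (auto simp: y_def power_le_one)
        then have "\<delta> * M * (1 - y) \<le> 1 * M * 1" using \<delta> M by (intro mult_mono) auto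
        moreover have "\<delta> * (y * G) \<le> \<delta> * (u \<rho> c / 2)" using True \<delta> by (intro mult_left_mono) auto
        ultimately show ?thesis by simp
      qed
      also have "\<dots> = M - d / 2" by (simp add: d_def)
      \<comment> \<open>As \<open>M \<le> W\<close>, the fixed decrease \<open>d / 2\<close> is at
        least the fraction \<open>d / (2 * W)\<close> of \<open>M\<close>.\<close>
      also have "\<dots> \<le> (1 - d / (2 * W)) * M"
        using M W d by (simp add: field_simps)
      also have "\<dots> \<le> \<theta> * M" using M by (intro mult_right_mono) (auto simp: \<theta>_def)
      finally show ?thesis .
    next
      case False
      then have y: "\<epsilon> \<le> y" using G by (simp add: \<epsilon>_def field_simps)
      \<comment> \<open>An opponent who bids for certain would force \<open>y = 0\<close>. Hence not
        bidding has positive probability and is optimal.\<close>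
      have "?p \<noteq> 1"
      proof
        assume "?p = 1"
        then have "y = 0" using card_active_minus(2)[OF h nt ia] by (simp add: y_def)
        with y \<epsilon> show False by simp
      qed
      with p have p1: "?p < 1" by simp
      obtain j where j: "j \<in> ?A'" using ex_opponent[OF h nt ia] .
      have "gain \<sigma> i h \<le> (\<Sum>B\<in>Pow ?A'. rest_prob ?p ?A' B * (if B = {j} then 0 else M))"
      proof (subst SSPE_gain(4)[OF sspe h nt ia p1], intro sum_mono mult_left_mono)
        fix B assume B: "B \<in> Pow ?A'"
        then have "valid re n (h @ [B])" using h nt by auto
        then have "gain \<sigma> i (h @ [B]) \<le> M" using i le by blast
        then show "gain \<sigma> i (h @ [B]) \<le> (if B = {j} then 0 else M)"
          by (auto simp: gain_terminal)
      qed (rule rest_prob_nonneg[OF p])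
      also have "\<dots> = M - rest_prob ?p ?A' {j} * M"
        using fin j by (subst sum_rest_prob_if) auto
      also have "\<dots> \<le> M - p0 * \<epsilon> * M"
      proof -
        \<comment> \<open>When \<open>j\<close> alone bids, one opponent fewer has to abstain, so
          the power can only grow.\<close>
        have "y \<le> (1 - ?p) ^ (card ?A' - 1)"
          unfolding y_def using p by (intro power_decreasing) auto
        then have "p0 * \<epsilon> \<le> rest_prob ?p ?A' {j}"
          unfolding rest_prob_single[OF fin j] using p_ge p0 \<epsilon> y p by (intro mult_mono) auto
        then show ?thesis using M by (intro diff_left_mono mult_right_mono) auto
      qed
      also have "\<dots> = (1 - p0 * \<epsilon>) * M" by (simp add: algebra_simps)
      also have "\<dots> \<le> \<theta> * M" using M by (intro mult_right_mono) (auto simp: \<theta>_def)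
      finally show ?thesis .
    qed
  qed
  moreover have "0 \<le> \<theta>" "\<theta> < 1" using W d p0 \<epsilon> by (auto simp: \<theta>_def)
  ultimately show ?thesis unfolding W_def by blast
qed

text \<open>All gains are at most \<open>W\<close> because winning has probability at most 1. The
  contraction, applied to all histories at once, improves this to
  \<open>\<theta> ^ k * W\<close>.\<close>

lemma SSPE_gain_eq_0:
  assumes sspe: "SSPE re n v c s \<rho> w0 \<sigma>" and h: "valid re n h" and i: "i < n"
  shows "gain \<sigma> i h = 0"
proof -
  define W where "W = u \<rho> (v - s - c)"
  have W: "W > 0" using u_prize_minus_c_pos by (simp add: W_def)
  from SSPE_gain_contraction[OF sspe] obtain \<theta> where \<theta>: "0 \<le> \<theta>" "\<theta> < 1"
    and contr: "\<And>M h i. 0 \<le> M \<Longrightarrow> M \<le> W \<Longrightarrow> (\<forall>g j. valid re n g \<and> j < n \<longrightarrow> gain \<sigma> j g \<le> M) \<Longrightarrow>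
      valid re n h \<Longrightarrow> i < n \<Longrightarrow> gain \<sigma> i h \<le> \<theta> * M"
    unfolding W_def by metis
  have bound: "\<forall>g j. valid re n g \<and> j < n \<longrightarrow> gain \<sigma> j g \<le> \<theta> ^ k * W" for k
  proof (induction k)
    case 0
    interpret d: prob_space dev by (rule prob_space_dev)
    have "gain \<sigma> j g \<le> W" if g: "valid re n g" and j: "j < n" for g j
    proof (cases "terminal g")
      case False
      have "gain \<sigma> j g \<le> W * measure dev {\<omega>. wins re n (\<lambda>_. \<sigma>) g \<omega> j}"
        unfolding W_def by (rule SSPE_gain_le_win_prob[OF sspe g False j])
      also have "\<dots> \<le> W * 1" using W by (intro mult_left_mono d.prob_le_1) auto
      finally show ?thesis by simp
    qed (use W in \<open>simp add: gain_terminal\<close>)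
    then show ?case by simp
  next
    case (Suc k)
    have "\<theta> ^ k * W \<le> 1 * W" using \<theta> W by (intro mult_right_mono power_le_one) auto
    then show ?case using contr[OF _ _ Suc] \<theta> W by (simp add: mult.assoc)
  qed
  have "(\<lambda>k. \<theta> ^ k * W) \<longlonglongrightarrow> 0 * W"
    using \<theta> by (intro tendsto_mult_right LIMSEQ_power_zero) auto
  then have "gain \<sigma> i h \<le> 0 * W"
    by (rule LIMSEQ_le_const) (use bound h i in auto)
  with SSPE_gain_nonneg[OF sspe h i] show ?thesis by simp
qed

text \<open>The lower bound excludes probability 0, so bidding is optimal. With all gains zero, its
  recursion is an equation for the probability that no opponent bids.\<close>

lemma SSPE_imp_bid_prob:
  assumes sspe: "SSPE re n v c s \<rho> w0 \<sigma>" and h: "valid re n h" "\<not> terminal h"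
  shows "\<sigma> h = bid_prob \<rho> v c s (card (active re n h))"
proof -
  let ?A = "active re n h"
  have fin: "finite ?A" by (rule finite_active[OF h(1)])
  have m: "card ?A \<ge> 2" by (rule card_active_ge2[OF n_ge_2 h])
  then obtain i where i: "i \<in> ?A" by fastforce
  have i_n: "i < n" using i active_subset[OF h(1)] by auto
  have p: "0 \<le> \<sigma> h" "\<sigma> h \<le> 1" using sspe by (auto simp: SSPE_def is_strategy_def)
  have "\<sigma> h \<noteq> 0"
    using SSPE_bid_prob_lower_bound[OF sspe h] u_prize_minus_c_pos by auto
  with p have p0: "\<sigma> h > 0" by simp
  let ?A' = "?A - {i}"
  have "gain \<sigma> i h = (\<Sum>B\<in>Pow ?A'. rest_prob (\<sigma> h) ?A' B *
      (if B = {} then u \<rho> (v - s - c) else - exp (\<rho> * c) * u \<rho> c))"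
    unfolding SSPE_gain(3)[OF sspe h i p0]
  proof (intro sum.cong refl)
    fix B assume "B \<in> Pow ?A'"
    then have "gain \<sigma> i (h @ [insert i B]) = 0"
      using h i by (intro SSPE_gain_eq_0[OF sspe _ i_n]) auto
    then show "rest_prob (\<sigma> h) ?A' B * (if B = {} then u \<rho> (v - s - c)
          else exp (\<rho> * c) * (gain \<sigma> i (h @ [insert i B]) - u \<rho> c)) =
        rest_prob (\<sigma> h) ?A' B * (if B = {} then u \<rho> (v - s - c) else - exp (\<rho> * c) * u \<rho> c)"
      by simp
  qed
  also have "\<dots> = exp (\<rho> * c) * ((1 - \<sigma> h) ^ (card ?A - 1) * u \<rho> (v - s) - u \<rho> c)"
    unfolding u_prize_minus_c using fin
    by (subst sum_rest_prob_if) (auto simp: rest_prob_empty card_active_minus(1)[OF h i] algebra_simps)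
  finally have "(1 - \<sigma> h) ^ (card ?A - 1) = u \<rho> c / u \<rho> (v - s)"
    using SSPE_gain_eq_0[OF sspe h(1) i_n] u_c_pos u_c_less by (simp add: field_simps)
  with m p show ?thesis by (intro eq_bid_probI)
qed

lemma SSPE_imp_EU:
  assumes sspe: "SSPE re n v c s \<rho> w0 \<sigma>" and h: "valid re n h" "\<not> terminal h" and i: "i < n"
  shows "EU re n v c s \<rho> w0 (\<lambda>_. \<sigma>) i h = ereal (u \<rho> (wealth c w0 i h))"
proof -
  have "val (\<lambda>_. \<sigma>) i h = pot i h"
    using val_gain[of \<sigma> i h] SSPE_gain_eq_0[OF sspe h(1) i] by simp
  with pot_le_val(1)[OF SSPE_loss_le[OF sspe h(1) i]]
  have "loss (\<lambda>_. \<sigma>) i h = ennreal (bd i - pot i h)" by (rule loss_eq_of_val)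
  then have "EU re n v c s \<rho> w0 (\<lambda>_. \<sigma>) i h = ereal (pot i h)"
    using EU_eq_iff[OF pot_le_bd] by blast
  then show ?thesis by (simp add: pot_nonterminal[OF h(2)])
qed

section \<open>Sufficiency: every deviation gives the same utility\<close>

text \<open>Against this probability a bid is a fair gamble in utility at every wealth level,
  because \<open>u_add\<close> factors wealth out.\<close>

lemma sum_pot_bidding:
  assumes g: "valid re n g" "\<not> terminal g" and i: "i \<in> active re n g"
    and p: "p = bid_prob \<rho> v c s (card (active re n g))"
  shows "(\<Sum>B\<in>Pow (active re n g - {i}). rest_prob p (active re n g - {i}) B * pot i (g @ [insert i B])) = pot i g"
proof -
  let ?A' = "active re n g - {i}"
  let ?w = "wealth c w0 i g"
  have fin: "finite ?A'" using finite_active[OF g(1)] by simp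
  have "(\<Sum>B\<in>Pow ?A'. rest_prob p ?A' B * pot i (g @ [insert i B])) =
      (\<Sum>B\<in>Pow ?A'. rest_prob p ?A' B * (if B = {} then u \<rho> (?w - c + (v - s)) else u \<rho> (?w - c)))"
    by (intro sum.cong refl) (auto simp: pot_snoc[OF g(2)])
  also have "\<dots> = u \<rho> (?w - c) + rest_prob p ?A' {} * (u \<rho> (?w - c + (v - s)) - u \<rho> (?w - c))"
    using fin by (subst sum_rest_prob_if) auto
  also have "rest_prob p ?A' {} = u \<rho> c / u \<rho> (v - s)"
    using bid_prob_power[OF card_active_ge2[OF n_ge_2 g]]
    by (simp add: rest_prob_empty card_active_minus(1)[OF g i] p)
  also have "u \<rho> (?w - c) + u \<rho> c / u \<rho> (v - s) * (u \<rho> (?w - c + (v - s)) - u \<rho> (?w - c)) = u \<rho> ?w"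
    using u_add[of \<rho> "?w - c" "v - s"] u_add[of \<rho> "?w - c" c] u_c_pos u_c_less by simp
  finally show ?thesis by (simp add: pot_nonterminal[OF g(2)])
qed

lemma self_le_bd: "\<not> terminal g \<Longrightarrow> wealth c w0 i g \<le> bd i"
  using u_ge_self[OF rho, of "wealth c w0 i g"] pot_le_bd[of i g] by (simp add: pot_nonterminal)

text \<open>Whatever \<open>\<tau>\<close> does, the potential is a martingale, and Fatou's lemma
  bounds the loss from above. For equality, the excess \<open>D\<close> of value over potential must
  not be positive: it vanishes once the game ends, which happens with probability at least
  \<open>\<epsilon>\<close> per stage while player \<open>i\<close> is active.\<close>

lemma loss_against_bid_prob:
  assumes \<sigma>: "is_strategy \<sigma>" and \<tau>: "is_strategy \<tau>" and i: "i < n"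
    and \<sigma>_eq: "\<And>h. valid re n h \<Longrightarrow> \<not> terminal h \<Longrightarrow> \<sigma> h = bid_prob \<rho> v c s (card (active re n h))"
    and h: "valid re n h"
  shows "loss ((\<lambda>_. \<sigma>)(i := \<tau>)) i h = ennreal (bd i - pot i h)"
proof -
  let ?P = "(\<lambda>_. \<sigma>)(i := \<tau>)"
  define r where "r = u \<rho> c / u \<rho> (v - s)"
  \<comment> \<open>\<open>r\<close> is the probability that no opponent bids, and
    \<open>(1 - r) / real n\<close> turns out to be a lower bound for the bidding
    probability.\<close>
  define \<epsilon> where "\<epsilon> = r * (1 - r) / real n"
  have r: "0 < r" "r < 1" using u_c_pos u_c_less by (auto simp: r_def)
  have P: "is_strategy (?P j)" for j using \<sigma> \<tau> by simp
  have mart: "(\<Sum>B\<in>Pow (active re n g). bid_set_prob re n ?P g B * pot i (g @ [B])) = pot i g"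
    if g: "valid re n g" "\<not> terminal g" for g
  proof (cases "i \<in> active re n g")
    case True
    have fin: "finite (active re n g)" by (rule finite_active[OF g(1)])
    show ?thesis
      by (subst sum_bid_set_prob_split[where p = "\<sigma> g" and i = i, OF fin True], simp,
          subst sum_pot_bidding[OF g True \<sigma>_eq[OF g]], subst sum_pot_not_bidding[OF g(2)])
        (use fin in \<open>auto simp: algebra_simps\<close>)
  qed (rule sum_pot_inactive[OF g])
  have upper: "loss ?P i g \<le> ennreal (bd i - pot i g)" if "valid re n g" for g
    by (rule loss_le_of_martingale[of ?P, OF P that mart])
  define D where "D = (\<lambda>g. val ?P i g - pot i g)"
  have D_0: "D g = 0" if "valid re n g" "terminal g \<or> i \<notin> active re n g" for g
    using that i by (auto simp: D_def val_terminal val_inactive)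
  have \<epsilon>_r: "\<epsilon> \<le> r"
  proof -
    have "(1 - r) / real n \<le> 1" using r n_ge_2 by (simp add: field_simps)
    then have "r * ((1 - r) / real n) \<le> r * 1" using r by (intro mult_left_mono) auto
    then show ?thesis by (simp add: \<epsilon>_def)
  qed
  have "0 < \<epsilon>" using r n_ge_2 by (simp add: \<epsilon>_def)
  moreover have "\<epsilon> < 1" using r \<epsilon>_r by linarith
  ultimately have \<epsilon>: "0 < \<epsilon>" "\<epsilon> < 1" .
  \<comment> \<open>The trivial bound on the excess after \<open>k\<close> further stages: fees
    reduce wealth by at most \<open>c * real k\<close>, and utility lies above the identity. The
    power bounds the probability of surviving that long.\<close>
  have D_le: "D g \<le> (1 - \<epsilon>) ^ k * (bd i - wealth c w0 i g + c * real k)"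
    if "valid re n g" "\<not> terminal g" for g k
    using that
  proof (induction k arbitrary: g)
    case 0
    have "val ?P i g \<le> bd i" by (simp add: val_def)
    then show ?case
      using u_ge_self[OF rho, of "wealth c w0 i g"] by (simp add: D_def pot_nonterminal[OF 0(2)])
  next
    case (Suc k)
    note g = Suc.prems
    define X where "X = (1 - \<epsilon>) ^ k * (bd i - wealth c w0 i g + c * real (Suc k))"
    have X: "0 \<le> X"
      unfolding X_def using \<epsilon> self_le_bd[OF g(2), of i] c_pos by (intro mult_nonneg_nonneg) auto
    show ?case
    proof (cases "i \<in> active re n g")
      case True
      let ?A = "active re n g" and ?A' = "active re n g - {i}"
      define p where "p = \<sigma> g"
      have fin: "finite ?A" by (rule finite_active[OF g(1)])
      have p01: "0 \<le> p" "p \<le> 1" using \<sigma> by (auto simp: p_def is_strategy_def)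
      have x01: "0 \<le> \<tau> g" "\<tau> g \<le> 1" using \<tau> by (auto simp: is_strategy_def)
      have y: "(1 - p) ^ card ?A' = r"
        using bid_prob_power[OF card_active_ge2[OF n_ge_2 g]]
        by (simp add: card_active_minus(1)[OF g True] p_def \<sigma>_eq[OF g] r_def)
      obtain j where j: "j \<in> ?A'" using ex_opponent[OF g True] .
      have "\<epsilon> \<le> rest_prob p ?A' {j}"
      proof -
        have "1 - real n * p \<le> r"
          using power_ge_one_minus_mult[OF p01 card_active_minus(3)[OF g True]] y by simp
        then have 1: "(1 - r) / real n \<le> p" using n_ge_2 by (simp add: field_simps)
        have 2: "r \<le> (1 - p) ^ (card ?A' - 1)"
          unfolding y[symmetric] using p01 by (intro power_decreasing) auto
        have "(1 - r) / real n * r \<le> p * (1 - p) ^ (card ?A' - 1)"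
          using 1 2 r p01 n_ge_2 by (intro mult_mono) auto
        then show ?thesis using fin j by (subst rest_prob_single) (auto simp: \<epsilon>_def mult.commute)
      qed
      then have 2: "rest_prob p ?A' {j} * X \<ge> \<epsilon> * X" using X by (intro mult_right_mono)
      have 1: "r * X \<ge> \<epsilon> * X" using X \<epsilon>_r by (intro mult_right_mono)
      \<comment> \<open>The one extra \<open>c\<close> in \<open>X\<close> absorbs the fee that
        player \<open>i\<close> may pay in this stage.\<close>
      have D_snoc: "D (g @ [B]) \<le> X" if B: "B \<subseteq> ?A" "card B \<noteq> 1" for B
      proof -
        have "D (g @ [B]) \<le> (1 - \<epsilon>) ^ k * (bd i - wealth c w0 i (g @ [B]) + c * real k)"
          using g B by (intro Suc.IH) auto
        also have "\<dots> \<le> X"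
          unfolding X_def using \<epsilon> c_pos
          by (intro mult_left_mono) (auto simp: wealth_snoc algebra_simps)
        finally show ?thesis .
      qed
      have D_fin: "loss ?P i (g @ [B]) \<noteq> \<top>" if "B \<subseteq> ?A" for B
        using g that by (intro pot_le_val(1)[OF upper]) auto
      have "D g = (\<Sum>B\<in>Pow ?A. bid_set_prob re n ?P g B * D (g @ [B]))"
        using mart[OF g] val_step(2)[of ?P, OF P g D_fin]
        by (simp add: D_def right_diff_distrib sum_subtractf)
      also have "\<dots> = \<tau> g * (\<Sum>B\<in>Pow ?A'. rest_prob p ?A' B * D (g @ [insert i B])) +
          (1 - \<tau> g) * (\<Sum>B\<in>Pow ?A'. rest_prob p ?A' B * D (g @ [B]))"
        using fin True by (subst sum_bid_set_prob_split[where p = p and i = i]) (auto simp: p_def)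
      \<comment> \<open>One game-ending set of bidders is singled out for each action. Other sets
        may also end the game, but there the excess 0 is still at most \<open>X\<close>.\<close>
      also have "\<dots> \<le> \<tau> g * (\<Sum>B\<in>Pow ?A'. rest_prob p ?A' B * (if B = {} then 0 else X)) +
          (1 - \<tau> g) * (\<Sum>B\<in>Pow ?A'. rest_prob p ?A' B * (if B = {j} then 0 else X))"
      proof (intro add_mono mult_left_mono sum_mono)
        fix B assume B: "B \<in> Pow ?A'"
        have v: "valid re n (g @ [insert i B])" "valid re n (g @ [B])" using B g True by auto
        show "D (g @ [insert i B]) \<le> (if B = {} then 0 else X)"
          using v D_snoc[of "insert i B"] D_0[OF v(1)] X B by (cases "card (insert i B) = 1") auto
        show "D (g @ [B]) \<le> (if B = {j} then 0 else X)"
          using v D_snoc[of B] D_0[OF v(2)] X B by (cases "card B = 1") auto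
      qed (use x01 rest_prob_nonneg[OF p01] in auto)
      also have "\<dots> = \<tau> g * (X - r * X) + (1 - \<tau> g) * (X - rest_prob p ?A' {j} * X)"
        using fin j by (simp add: sum_rest_prob_if rest_prob_empty y)
      also have "\<dots> \<le> \<tau> g * (X - \<epsilon> * X) + (1 - \<tau> g) * (X - \<epsilon> * X)"
        using 1 2 x01 by (intro add_mono mult_left_mono diff_left_mono) auto
      also have "\<dots> = (1 - \<epsilon>) * X" by (simp add: algebra_simps)
      finally show ?thesis by (simp add: X_def mult.assoc)
    next
      case False
      then have "D g = 0" by (intro D_0 g) simp
      also have "0 \<le> (1 - \<epsilon>) * X" using X \<epsilon> by simp
      finally show ?thesis by (simp add: X_def mult.assoc)
    qed
  qed
  have "D h \<le> 0"
  proof (cases "terminal h")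
    case False
    \<comment> \<open>Geometric decay outweighs the linear growth of the fees.\<close>
    have "(\<lambda>k. (1 - \<epsilon>) ^ k * (bd i - wealth c w0 i h) + c * (real k * (1 - \<epsilon>) ^ k)) \<longlonglongrightarrow>
        0 * (bd i - wealth c w0 i h) + c * 0"
      using \<epsilon> by (intro tendsto_intros LIMSEQ_power_zero powser_times_n_limit_0) auto
    then have "D h \<le> 0 * (bd i - wealth c w0 i h) + c * 0"
      by (rule LIMSEQ_le_const) (use D_le[OF h False] in \<open>auto simp: algebra_simps\<close>)
    then show ?thesis by simp
  qed (use D_0[OF h] in simp)
  then have "val ?P i h = pot i h"
    using pot_le_val(2)[OF upper[OF h]] by (simp add: D_def)
  with pot_le_val(1)[OF upper[OF h]] show ?thesis by (rule loss_eq_of_val)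
qed

text \<open>For the converse, every deviation yields the same loss as \<open>\<sigma>\<close>
  itself, so no deviation is profitable. A strategy is pinned down only at valid nonterminal
  histories, the only ones at which \<open>SSPE\<close> tests deviations.\<close>

lemma SSPE_iff:
  "SSPE re n v c s \<rho> w0 \<sigma> \<longleftrightarrow> is_strategy \<sigma> \<and>
    (\<forall>h. valid re n h \<and> \<not> terminal h \<longrightarrow> \<sigma> h = bid_prob \<rho> v c s (card (active re n h)))"
proof
  assume "SSPE re n v c s \<rho> w0 \<sigma>"
  then show "is_strategy \<sigma> \<and>
      (\<forall>h. valid re n h \<and> \<not> terminal h \<longrightarrow> \<sigma> h = bid_prob \<rho> v c s (card (active re n h)))"
    using SSPE_imp_bid_prob by (auto simp: SSPE_def)
next
  assume \<sigma>: "is_strategy \<sigma> \<and>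
    (\<forall>h. valid re n h \<and> \<not> terminal h \<longrightarrow> \<sigma> h = bid_prob \<rho> v c s (card (active re n h)))"
  have "loss (\<lambda>_. \<sigma>) i h \<le> loss ((\<lambda>_. \<sigma>)(i := \<tau>)) i h"
    if "valid re n h" "i < n" "is_strategy \<tau>" for h i \<tau>
  proof -
    have "(\<lambda>_. \<sigma>)(i := \<sigma>) = (\<lambda>_. \<sigma>)" by auto
    then show ?thesis
      using loss_against_bid_prob[of \<sigma> \<tau> i h] loss_against_bid_prob[of \<sigma> \<sigma> i h] \<sigma> that by simp
  qed
  with \<sigma> show "SSPE re n v c s \<rho> w0 \<sigma>" by (auto simp: SSPE_def EU_le_iff)
qed

end

theorem theorem1:
  fixes re :: bool and n :: nat and v c s \<rho> :: real and w0 :: "nat \<Rightarrow> real"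
  assumes "n \<ge> 2" and "v > 0" and "c > 0" and "s \<ge> 0" and "c < v - s" and "\<rho> \<le> 0"
  shows
    "(\<forall>\<sigma>. SSPE re n v c s \<rho> w0 \<sigma> \<longrightarrow>
        (\<forall>h i. valid re n h \<and> \<not> terminal h \<and> i < n \<longrightarrow>
           EU re n v c s \<rho> w0 (\<lambda>_. \<sigma>) i h = ereal (u \<rho> (wealth c w0 i h))))
   \<and> (\<forall>h. valid re n h \<and> \<not> terminal h \<longrightarrow>
        (let m = (if re then n else card (active re n h)) in
           0 < bid_prob \<rho> v c s m \<and> bid_prob \<rho> v c s m < 1))
   \<and> (\<forall>\<sigma>. SSPE re n v c s \<rho> w0 \<sigma> \<longleftrightarrow>
        is_strategy \<sigma> \<and>
        (\<forall>h. valid re n h \<and> \<not> terminal h \<longrightarrow>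
           \<sigma> h = bid_prob \<rho> v c s (if re then n else card (active re n h))))"
proof -
  interpret pay_to_bid re n v c s \<rho> w0 by unfold_locales (use assms in auto)
  \<comment> \<open>With re-entry all players stay active, so both versions follow from the formula
    in the number of active players.\<close>
  have m: "(if re then n else card (active re n h)) = card (active re n h)" for h
    by (cases re) (simp_all add: active_reentry)
  show ?thesis
    unfolding m Let_def SSPE_iff[symmetric]
    using SSPE_imp_EU bid_prob_bounds card_active_ge2[OF n_ge_2] by blast
qed

end
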